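(* For $N_1,N_2\ge1$ consider $W(\mathsf D_{N_1+N_2+1})$ with indices $\{1,\dots,N_1+N_2+1\}$, and put $\ast=N_1+N_2+1$. Realize a group $G$ on the indices $\{1,\dots,N_1\}\cup\{\ast\}$ and a group $G'$ on the indices $\{N_1+1,\dots,N_1+N_2\}\cup\{\ast\}$ (shifting the indices $1,\dots,N_2$ of $G'$ by $N_1$), where each of $G,G'$ is one of the following (with its length-one orbit identified with $\ast$): (a) $\mathfrak D_{2m+1}$, $N=2m+1$: generated by $g_1=c_1c_2\cdots c_{2m+1}c_\ast(2,3)(4,5)\cdots(2m,2m+1)$ and the $(2m+1)$-cycle $g_2=(1,2,4,6,\dots,2m,2m+1,2m-1,\dots,5,3)$; (b) $\mathfrak F_{q}$, $q=p^r$ with $p$ an odd prime, $N=q$: generated by $g_1=c_1\cdots c_{q}c_\ast\,\mu_\Gamma$ and $g_2=\nu$, where, identifying $\{1,\dots,q\}$ with $\mathbb F_q$ via the labelling $\mathrm{lab}$ below, $\mu_\Gamma(\mathrm{lab}(a))=\mathrm{lab}(\Gamma a)$ for a fixed generator $\Gamma$ of $\mathbb F_q^*$ and $\nu(\mathrm{lab}(a))=\mathrm{lab}(a+1)$. Then the subgroups $\mathfrak D_{2n_1+1}\times\mathfrak D_{2n_2+1}$ (both factors of type (a)) and $\mathfrak D_{2n+1}\times\mathfrak F_{p^r}$ (first factor of type (a), second of type (b)) of $W(\mathsf D_{N_1+N_2+1})$ generated by the four generators satisfy the (H1) condition and the relative minimality condition.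
   Context: $W(\mathsf B_m)$ is the group of signed permutations of the symbols $j^\pm$ ($1\le j\le m$), generated by permutations of indices and involutions $c_j$ exchanging $j^+,j^-$; elements are $c_{j_1}\cdots c_{j_t}\tau$; $\sigma(\cdot)=(-1)^t$; $W(\mathsf D_m)=\ker\sigma$. $W(\mathsf D_m)$ acts on $\bigoplus_{i=-1}^m\mathbb Zl_i$ (the geometric Picard lattice of a standard conic bundle with $m$ degenerate fibers) via $\Phi$: for $g=c_{j_1}\cdots c_{j_t}\tau$ with $s(i)=-1$ iff $i\in\{j_1,\dots,j_t\}$, $\Phi(g)l_0=l_0$, $\Phi(g)l_{-1}=l_{-1}+\frac t2l_0-\sum_{s(i)=-1}l_i$, $\Phi(g)l_v=l_u$ or $l_0-l_u$ ($u=\tau^{-1}(v)$) according as $s(u)=1$ or $-1$. A subgroup $H$ satisfies (H1) if $\mathrm H^1(H',\mathbb Z^{m+2})=0$ for all subgroups $H'\subseteq H$, and relative minimality if its invariant sublattice is $\mathbb Zl_0\oplus\mathbb ZK$, $K=-2(l_{-1}+l_0)+\sum_{i=1}^ml_i$. Labelling: $\mathbb F_{p^r}=(\mathbb Z/p)[x]/(h(x))$ with $h$ monic irreducible of degree $r$; for $a=a_0+a_1x+\dots+a_{r-1}x^{r-1}$ ($a_i\in\{0,\dots,p-1\}$), $\mathrm{lab}(a)=a_0+a_1p+\dots+a_{r-1}p^{r-1}$ if $a\ne0$ and $\mathrm{lab}(0)=p^r$. Permutations written in cycle notation $(a_1,\dots,a_w)$ send $a_i\mapsto a_{i+1}$.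 *)

theory Defs
  imports "HOL-Algebra.Bij" "HOL-Algebra.Generated_Groups" "Berlekamp_Zassenhaus.Finite_Field"
begin

text \<open>An element c_{j_1}...c_{j_t} tau of W(B_M) is represented by the pair (J, tau),
  J = {j_1,...,j_t} (subset of {1..M}), tau a permutation of {1..M} (identity elsewhere).\<close>
type_synonym sgn_perm = "int set \<times> (int \<Rightarrow> int)"

text \<open>The lattice Z l_{-1} + Z l_0 + ... + Z l_M, vectors as coordinate functions.\<close>
definition lat :: "nat \<Rightarrow> (int \<Rightarrow> int) set" where
  "lat M = {x. \<forall>i. (i < -1 \<or> i > int M) \<longrightarrow> x i = 0}"

definition lb :: "int \<Rightarrow> int \<Rightarrow> int" where
  "lb i = (\<lambda>k. if k = i then 1 else 0)"

definition phi_basis :: "nat \<Rightarrow> sgn_perm \<Rightarrow> int \<Rightarrow> (int \<Rightarrow> int)" where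
  "phi_basis M g i =
    (let J = fst g; \<tau> = snd g in
     if i = 0 then lb 0
     else if i = -1 then (\<lambda>k. lb (-1) k + (int (card J) div 2) * lb 0 k - (\<Sum>j\<in>J. lb j k))
     else (let u = inv_into {1..int M} \<tau> i in
           if u \<notin> J then lb u else (\<lambda>k. lb 0 k - lb u k)))"

definition Phi :: "nat \<Rightarrow> sgn_perm \<Rightarrow> (int \<Rightarrow> int) \<Rightarrow> (int \<Rightarrow> int)" where
  "Phi M g = (\<lambda>x. \<lambda>k. \<Sum>i\<in>{-1..int M}. x i * phi_basis M g i k)"

definition gen_grp :: "nat \<Rightarrow> sgn_perm set \<Rightarrow> ((int \<Rightarrow> int) \<Rightarrow> (int \<Rightarrow> int)) set" where
  "gen_grp M gens = generate (BijGroup (lat M)) ((\<lambda>g. restrict (Phi M g) (lat M)) ` gens)"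

definition H1_vanish :: "(int \<Rightarrow> int) set \<Rightarrow> ((int \<Rightarrow> int) \<Rightarrow> (int \<Rightarrow> int)) set \<Rightarrow> bool" where
  "H1_vanish S H' \<longleftrightarrow>
    (\<forall>f. ((\<forall>\<sigma>\<in>H'. f \<sigma> \<in> S) \<and>
          (\<forall>\<sigma>\<in>H'. \<forall>\<rho>\<in>H'. f (\<sigma> \<otimes>\<^bsub>BijGroup S\<^esub> \<rho>) = (\<lambda>k. f \<sigma> k + \<sigma> (f \<rho>) k)))
       \<longrightarrow> (\<exists>v\<in>S. \<forall>\<sigma>\<in>H'. f \<sigma> = (\<lambda>k. \<sigma> v k - v k)))"

definition cond_H1 :: "nat \<Rightarrow> ((int \<Rightarrow> int) \<Rightarrow> (int \<Rightarrow> int)) set \<Rightarrow> bool" where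
  "cond_H1 M H \<longleftrightarrow>
    (\<forall>H'. subgroup H' (BijGroup (lat M)) \<and> H' \<subseteq> H \<longrightarrow> H1_vanish (lat M) H')"

definition Kcan :: "nat \<Rightarrow> int \<Rightarrow> int" where
  "Kcan M = (\<lambda>k. -2 * (lb (-1) k + lb 0 k) + (\<Sum>i\<in>{1..int M}. lb i k))"

definition rel_min :: "nat \<Rightarrow> ((int \<Rightarrow> int) \<Rightarrow> (int \<Rightarrow> int)) set \<Rightarrow> bool" where
  "rel_min M H \<longleftrightarrow>
    {x \<in> lat M. \<forall>\<sigma>\<in>H. \<sigma> x = x} = {(\<lambda>k. a * lb 0 k + b * Kcan M k) | a b. True}"

definition cyc :: "int list \<Rightarrow> int \<Rightarrow> int" where
  "cyc xs x = (case map_of (zip xs (tl xs @ [hd xs])) x of None \<Rightarrow> x | Some y \<Rightarrow> y)"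

section \<open>Type (a): D_{2m+1}, indices shifted by off, length-one orbit at index s\<close>

definition dih_swap :: "nat \<Rightarrow> int \<Rightarrow> int \<Rightarrow> int" where
  "dih_swap m off x = (if off + 2 \<le> x \<and> x \<le> off + 2 * int m + 1
                     then (if even (x - off) then x + 1 else x - 1) else x)"

definition dih_list :: "nat \<Rightarrow> int \<Rightarrow> int list" where
  "dih_list m off = map (\<lambda>x. x + off)
     ([1] @ map (\<lambda>k. 2 * k) [1..int m] @ rev (map (\<lambda>k. 2 * k + 1) [1..int m]))"

definition dih_gens :: "nat \<Rightarrow> int \<Rightarrow> int \<Rightarrow> sgn_perm set" where
  "dih_gens m off s = {({off + 1..off + 2 * int m + 1} \<union> {s}, dih_swap m off), ({}, cyc (dih_list m off))}"

section \<open>Type (b): F_q, q = p^r, F_q = (Z/p)[x]/(h)\<close>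

text \<open>Elements of F_q are represented by polynomials of degree < deg h; labelling lab.\<close>
definition lab :: "'p::prime_card mod_ring poly \<Rightarrow> 'p mod_ring poly \<Rightarrow> int" where
  "lab h a = (if a = 0 then int (CARD('p) ^ degree h)
              else (\<Sum>i<degree h. to_int_mod_ring (coeff a i) * int CARD('p) ^ i))"

definition ff_perm :: "'p::prime_card mod_ring poly \<Rightarrow> ('p mod_ring poly \<Rightarrow> 'p mod_ring poly)
    \<Rightarrow> int \<Rightarrow> int \<Rightarrow> int" where
  "ff_perm h f off x =
     (if \<exists>a. degree a < degree h \<and> x = off + lab h a
      then off + lab h (f (THE a. degree a < degree h \<and> x = off + lab h a)) else x)"

definition is_mult_generator :: "'p::prime_card mod_ring poly \<Rightarrow> 'p mod_ring poly \<Rightarrow> bool" where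
  "is_mult_generator h \<Gamma> \<longleftrightarrow> degree \<Gamma> < degree h \<and> \<Gamma> \<noteq> 0 \<and>
     (\<forall>a. degree a < degree h \<and> a \<noteq> 0 \<longrightarrow> (\<exists>k::nat. a = \<Gamma> ^ k mod h))"

definition ff_gens :: "'p::prime_card mod_ring poly \<Rightarrow> 'p mod_ring poly \<Rightarrow> int \<Rightarrow> int \<Rightarrow> sgn_perm set" where
  "ff_gens h \<Gamma> off s =
     {({off + 1..off + int (CARD('p) ^ degree h)} \<union> {s}, ff_perm h (\<lambda>a. (\<Gamma> * a) mod h) off),
      ({}, ff_perm h (\<lambda>a. a + 1) off)}"

end

theory Submission
  imports Defs
begin

text \<open>Let \<open>H'\<close> be a subgroup of the product group.  Its elements permute each of the two blocks of
  indices, and on each block they flip either all signs or none.  The subgroup without flips has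
  index a power of two and permutes the basis of the lattice.  Since both blocks have odd size,
  \<open>H'\<close> has an odd orbit on the first block and the stabiliser of a point of it has an odd orbit on
  the second, so the stabiliser \<open>L\<close> of suitable points \<open>a\<close>, \<open>b\<close> of the two blocks has odd index; an
  element of \<open>L\<close> that fixes a further point of a block does not flip that block (the two factors
  are groups of affine maps), and therefore the lattice is a permutation module for \<open>L\<close> as well.
  As permutation modules have vanishing first cohomology, every cocycle of \<open>H'\<close> becomes a
  coboundary after multiplication by a power of two and by an odd number, hence is one.\<close>

section \<open>Cocycles of finite groups acting on a lattice\<close>

text \<open>A flip at k replaces the coordinate x_k by -x_{-1} - x_k: it exchanges the components
  l_k and l_0 - l_k of a degenerate fibre. So the given basis is permuted only by flip-free
  elements, and a permuted basis for anything larger needs an invariant choice of components. In the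
  stabiliser of a point of each block such a choice exists over the remaining points of the blocks.
  Indeed a flip of a block comes from an affine map x -> u x + c with u = -1 (dihedral) or u an odd
  power of \<Gamma> (field); then u is not 1 and the map has at most one fixed point. The choice is
  impossible at the two stabilised points and at the extra index whenever these are flipped, and
  three fibres with signs e1, e2 and e1 + e2 are left over; they need a basis of a different kind,
  made of sections instead of fibre components. The formulas come from the intersection form l_0^2 =
  l_{-1}^2 = 0, l_0.l_{-1} = 1, l_i^2 = -1. For instance x_{-1} = x.l_0, and \<open>deg\<close> is
  -K.x - 2 x_{-1}, which explains its invariance.\<close>

definition cocycle :: "(int \<Rightarrow> int) set \<Rightarrow> ((int \<Rightarrow> int) \<Rightarrow> (int \<Rightarrow> int)) set \<Rightarrow>
    (((int \<Rightarrow> int) \<Rightarrow> (int \<Rightarrow> int)) \<Rightarrow> (int \<Rightarrow> int)) \<Rightarrow> bool" where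
  "cocycle S H f \<longleftrightarrow> (\<forall>\<sigma>\<in>H. f \<sigma> \<in> S) \<and>
     (\<forall>\<sigma>\<in>H. \<forall>\<rho>\<in>H. f (\<sigma> \<otimes>\<^bsub>BijGroup S\<^esub> \<rho>) = (\<lambda>k. f \<sigma> k + \<sigma> (f \<rho>) k))"

text \<open>Says that n annihilates the class of f in H^1, without forming the quotient group. The
  factor n is what is tracked on the way from a subgroup back to the group.\<close>

definition multiple_coboundary :: "(int \<Rightarrow> int) set \<Rightarrow> ((int \<Rightarrow> int) \<Rightarrow> (int \<Rightarrow> int)) set \<Rightarrow> int \<Rightarrow>
    (((int \<Rightarrow> int) \<Rightarrow> (int \<Rightarrow> int)) \<Rightarrow> (int \<Rightarrow> int)) \<Rightarrow> bool" where
  "multiple_coboundary S H n f \<longleftrightarrow> (\<exists>v\<in>S. \<forall>\<sigma>\<in>H. \<forall>k. n * f \<sigma> k = \<sigma> v k - v k)"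

lemma H1_vanish_iff: "H1_vanish S H \<longleftrightarrow> (\<forall>f. cocycle S H f \<longrightarrow> multiple_coboundary S H 1 f)"
  by (simp add: H1_vanish_def cocycle_def multiple_coboundary_def fun_eq_iff)

lemma cocycle_subset: "cocycle S H f \<Longrightarrow> L \<subseteq> H \<Longrightarrow> cocycle S L f"
  unfolding cocycle_def by blast

text \<open>\<open>BijGroup S\<close> consists of all bijections of the underlying set, so
  additivity is a separate assumption, from which linearity over the integers is derived. Finiteness
  of H gives sums over H a meaning.\<close>

locale lattice_action =
  fixes S :: "(int \<Rightarrow> int) set" and H :: "((int \<Rightarrow> int) \<Rightarrow> (int \<Rightarrow> int)) set"
  assumes zero_closed: "(\<lambda>_. 0) \<in> S"
    and plus_closed: "\<And>x y. x \<in> S \<Longrightarrow> y \<in> S \<Longrightarrow> (\<lambda>k. x k + y k) \<in> S"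
    and uminus_closed: "\<And>x. x \<in> S \<Longrightarrow> (\<lambda>k. - x k) \<in> S"
    and subgroup_H: "subgroup H (BijGroup S)"
    and finite_H: "finite H"
    and act_plus: "\<And>\<sigma> x y. \<sigma> \<in> H \<Longrightarrow> x \<in> S \<Longrightarrow> y \<in> S \<Longrightarrow>
                     \<sigma> (\<lambda>k. x k + y k) = (\<lambda>k. \<sigma> x k + \<sigma> y k)"
begin

interpretation B: group "BijGroup S" by (rule group_BijGroup)

abbreviation mul (infixl "\<star>" 70) where "\<sigma> \<star> \<rho> \<equiv> \<sigma> \<otimes>\<^bsub>BijGroup S\<^esub> \<rho>"

lemma in_Bij: "\<sigma> \<in> H \<Longrightarrow> \<sigma> \<in> Bij S"
  using subgroup.subset[OF subgroup_H] by (auto simp: BijGroup_def)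

lemma in_carrier: "\<sigma> \<in> H \<Longrightarrow> \<sigma> \<in> carrier (BijGroup S)"
  using subgroup.subset[OF subgroup_H] by auto

lemma act_closed: "\<sigma> \<in> H \<Longrightarrow> x \<in> S \<Longrightarrow> \<sigma> x \<in> S"
  using in_Bij by (auto simp: Bij_def bij_betw_def)

lemma mult_closed: "\<sigma> \<in> H \<Longrightarrow> \<rho> \<in> H \<Longrightarrow> \<sigma> \<star> \<rho> \<in> H"
  by (rule subgroup.m_closed[OF subgroup_H])

lemma inv_closed: "\<sigma> \<in> H \<Longrightarrow> inv\<^bsub>BijGroup S\<^esub> \<sigma> \<in> H"
  by (rule subgroup.m_inv_closed[OF subgroup_H])

lemma one_closed: "\<one>\<^bsub>BijGroup S\<^esub> \<in> H"
  by (rule subgroup.one_closed[OF subgroup_H])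

lemma mult_act: "\<sigma> \<in> H \<Longrightarrow> \<rho> \<in> H \<Longrightarrow> x \<in> S \<Longrightarrow> (\<sigma> \<star> \<rho>) x = \<sigma> (\<rho> x)"
  by (simp add: BijGroup_def in_Bij compose_def)

lemma act_zero: "\<sigma> \<in> H \<Longrightarrow> \<sigma> (\<lambda>_. 0) = (\<lambda>_. 0)"
  using act_plus[of \<sigma> "\<lambda>_. 0" "\<lambda>_. 0"] zero_closed by (simp add: fun_eq_iff)

lemma act_uminus: "\<sigma> \<in> H \<Longrightarrow> x \<in> S \<Longrightarrow> \<sigma> (\<lambda>k. - x k) = (\<lambda>k. - \<sigma> x k)"
  using act_plus[of \<sigma> x "\<lambda>k. - x k"] act_zero[of \<sigma>] uminus_closed[of x]
  by (simp add: fun_eq_iff) (metis add.commute add_eq_0_iff2)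

lemma minus_closed: "x \<in> S \<Longrightarrow> y \<in> S \<Longrightarrow> (\<lambda>k. x k - y k) \<in> S"
  using plus_closed[of x "\<lambda>k. - y k"] uminus_closed[of y] by simp

lemma act_minus: "\<sigma> \<in> H \<Longrightarrow> x \<in> S \<Longrightarrow> y \<in> S \<Longrightarrow> \<sigma> (\<lambda>k. x k - y k) = (\<lambda>k. \<sigma> x k - \<sigma> y k)"
  using act_plus[of \<sigma> x "\<lambda>k. - y k"] uminus_closed[of y] act_uminus[of \<sigma> y] by simp

lemma sum_closed: "(\<And>i. i \<in> I \<Longrightarrow> g i \<in> S) \<Longrightarrow> (\<lambda>k. \<Sum>i\<in>I. g i k) \<in> S"
proof (induction I rule: infinite_finite_induct)
  case (insert i I)
  then show ?case using plus_closed[of "g i" "\<lambda>k. \<Sum>i\<in>I. g i k"] by auto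
qed (auto simp: zero_closed)

lemma act_sum: "\<sigma> \<in> H \<Longrightarrow> (\<And>i. i \<in> I \<Longrightarrow> g i \<in> S) \<Longrightarrow>
    \<sigma> (\<lambda>k. \<Sum>i\<in>I. g i k) = (\<lambda>k. \<Sum>i\<in>I. \<sigma> (g i) k)"
proof (induction I rule: infinite_finite_induct)
  case (insert i I)
  then show ?case using act_plus[of \<sigma> "g i" "\<lambda>k. \<Sum>i\<in>I. g i k"] sum_closed[of I g] by auto
qed (auto simp: act_zero)

lemma times_nat_closed: "x \<in> S \<Longrightarrow> (\<lambda>k. int n * x k) \<in> S"
  using sum_closed[of "{..<n}" "\<lambda>_. x"] by simp

lemma act_times_nat: "\<sigma> \<in> H \<Longrightarrow> x \<in> S \<Longrightarrow> \<sigma> (\<lambda>k. int n * x k) = (\<lambda>k. int n * \<sigma> x k)"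
  using act_sum[of \<sigma> "{..<n}" "\<lambda>_. x"] by simp

lemma times_closed:
  assumes "x \<in> S" shows "(\<lambda>k. n * x k) \<in> S"
proof (cases n)
  case (nonneg m)
  then show ?thesis using times_nat_closed[OF assms] by simp
next
  case (neg m)
  then show ?thesis using uminus_closed[OF times_nat_closed[OF assms, of "Suc m"]]
    by (simp only: mult_minus_left)
qed

lemma act_times:
  assumes "\<sigma> \<in> H" "x \<in> S" shows "\<sigma> (\<lambda>k. n * x k) = (\<lambda>k. n * \<sigma> x k)"
proof (cases n)
  case (nonneg m)
  then show ?thesis using act_times_nat[OF assms] by simp
next
  case (neg m)
  have "\<sigma> (\<lambda>k. - (int (Suc m) * x k)) = (\<lambda>k. - (int (Suc m) * \<sigma> x k))"
    by (simp only: act_uminus[OF assms(1) times_nat_closed[OF assms(2)]] act_times_nat[OF assms])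
  then show ?thesis using neg by (simp only: mult_minus_left)
qed

lemma left_translate: "\<sigma> \<in> H \<Longrightarrow> bij_betw ((\<star>) \<sigma>) H H"
proof -
  assume s: "\<sigma> \<in> H"
  have "inj_on ((\<star>) \<sigma>) H"
    using s in_carrier by (auto intro!: inj_onI)
  moreover have "(\<star>) \<sigma> ` H \<subseteq> H" using s mult_closed by auto
  ultimately show ?thesis
    by (simp add: bij_betw_def endo_inj_surj finite_H)
qed

text \<open>Over the rationals a cocycle is the coboundary of minus its average; when the group permutes
  integral coordinates, rounding this average down coordinatewise does not change the coboundary.\<close>

lemma permutation_coboundary:
  fixes \<phi> :: "'i \<Rightarrow> (int \<Rightarrow> int) \<Rightarrow> int"
  assumes f: "cocycle S H f"
    and phi_plus: "\<And>i x y. i \<in> X \<Longrightarrow> x \<in> S \<Longrightarrow> y \<in> S \<Longrightarrow> \<phi> i (\<lambda>k. x k + y k) = \<phi> i x + \<phi> i y"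
    and perm: "\<And>\<sigma> i. \<sigma> \<in> H \<Longrightarrow> i \<in> X \<Longrightarrow> \<exists>j\<in>X. \<forall>x\<in>S. \<phi> i (\<sigma> x) = \<phi> j x"
    and inj: "\<And>x y. x \<in> S \<Longrightarrow> y \<in> S \<Longrightarrow> (\<And>i. i \<in> X \<Longrightarrow> \<phi> i x = \<phi> i y) \<Longrightarrow> x = y"
    and surj: "\<And>q. \<exists>x\<in>S. \<forall>i\<in>X. \<phi> i x = q i"
  shows "multiple_coboundary S H 1 f"
proof -
  define w where "w = (\<lambda>k. \<Sum>\<rho>\<in>H. f \<rho> k)"
  define n where "n = int (card H)"
  have n: "n > 0" unfolding n_def using finite_H one_closed by (auto simp: card_gt_0_iff)
  have fS: "\<And>\<sigma>. \<sigma> \<in> H \<Longrightarrow> f \<sigma> \<in> S" using f by (auto simp: cocycle_def)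
  have wS: "w \<in> S" unfolding w_def by (rule sum_closed) (rule fS)
  \<comment> \<open>The cocycle identity is summed over \<rho>, after reindexing H by left
    translation with \<sigma>.\<close>
  have key: "w = (\<lambda>k. n * f \<sigma> k + \<sigma> w k)" if s: "\<sigma> \<in> H" for \<sigma>
  proof
    fix k
    have "w k = (\<Sum>\<rho>\<in>H. f (\<sigma> \<star> \<rho>) k)"
      unfolding w_def by (rule sum.reindex_bij_betw[OF left_translate[OF s], symmetric])
    also have "\<dots> = (\<Sum>\<rho>\<in>H. f \<sigma> k + \<sigma> (f \<rho>) k)"
      using f s by (auto simp: cocycle_def)
    also have "\<dots> = n * f \<sigma> k + \<sigma> w k"
      using act_sum[OF s, of H f, OF fS] by (simp add: sum.distrib n_def w_def)
    finally show "w k = n * f \<sigma> k + \<sigma> w k" .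
  qed
  have phi_times: "\<phi> i (\<lambda>k. int m * x k) = int m * \<phi> i x" if "i \<in> X" "x \<in> S" for i x m
  proof (induction m)
    case 0
    show ?case using phi_plus[of i "\<lambda>_. 0" "\<lambda>_. 0"] that zero_closed by simp
  next
    case (Suc m)
    have "\<phi> i (\<lambda>k. int (Suc m) * x k) = \<phi> i (\<lambda>k. x k + int m * x k)" by (simp add: algebra_simps)
    also have "\<dots> = \<phi> i x + \<phi> i (\<lambda>k. int m * x k)"
      by (intro phi_plus that times_closed)
    finally show ?case using Suc by (simp add: algebra_simps)
  qed
  obtain v where v: "v \<in> S" "\<And>i. i \<in> X \<Longrightarrow> \<phi> i v = (- \<phi> i w) div n"
    using surj[of "\<lambda>i. (- \<phi> i w) div n"] by auto
  have "\<sigma> v = (\<lambda>k. f \<sigma> k + v k)" if s: "\<sigma> \<in> H" for \<sigma>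
  proof (rule inj)
    show "\<sigma> v \<in> S" "(\<lambda>k. f \<sigma> k + v k) \<in> S"
      using s v act_closed plus_closed fS by auto
    fix i assume i: "i \<in> X"
    obtain j where j: "j \<in> X" "\<And>x. x \<in> S \<Longrightarrow> \<phi> i (\<sigma> x) = \<phi> j x" using perm[OF s i] by blast
    have "\<phi> i w = \<phi> i (\<lambda>k. n * f \<sigma> k + \<sigma> w k)" using key[OF s] by simp
    also have "\<dots> = n * \<phi> i (f \<sigma>) + \<phi> j w"
      using phi_plus[OF i times_closed[OF fS[OF s], of n] act_closed[OF s wS]]
        phi_times[OF i fS[OF s], of "card H"] j(2)[OF wS] by (simp add: n_def)
    finally have "- \<phi> j w = - \<phi> i w + n * \<phi> i (f \<sigma>)" by simp
    hence "(- \<phi> j w) div n = (- \<phi> i w) div n + \<phi> i (f \<sigma>)"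
      using n div_mult_self2[of n "- \<phi> i w" "\<phi> i (f \<sigma>)"] by simp
    thus "\<phi> i (\<sigma> v) = \<phi> i (\<lambda>k. f \<sigma> k + v k)"
      using v i j phi_plus[OF i fS[OF s] v(1)] by simp
  qed
  hence "\<forall>\<sigma>\<in>H. \<forall>k. 1 * f \<sigma> k = \<sigma> v k - v k" by simp
  thus ?thesis unfolding multiple_coboundary_def using v(1) by blast
qed

text \<open>The map \<^term>\<open>ev\<close> below separates the left cosets of the subgroup.\<close>

lemma fibre_subgroup:
  fixes ev :: "((int \<Rightarrow> int) \<Rightarrow> (int \<Rightarrow> int)) \<Rightarrow> 'b"
  assumes ev: "\<And>\<sigma> \<rho> \<rho>'. \<sigma> \<in> H \<Longrightarrow> \<rho> \<in> H \<Longrightarrow> \<rho>' \<in> H \<Longrightarrow> ev \<rho> = ev \<rho>' \<Longrightarrow> ev (\<sigma> \<star> \<rho>) = ev (\<sigma> \<star> \<rho>')"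
  shows "subgroup {\<sigma> \<in> H. ev \<sigma> = ev \<one>\<^bsub>BijGroup S\<^esub>} (BijGroup S)"
proof (rule B.subgroupI)
  let ?L = "{\<sigma> \<in> H. ev \<sigma> = ev \<one>\<^bsub>BijGroup S\<^esub>}"
  show "?L \<subseteq> carrier (BijGroup S)" using in_carrier by auto
  show "?L \<noteq> {}" using one_closed by auto
  fix a assume a: "a \<in> ?L"
  have "ev (inv\<^bsub>BijGroup S\<^esub> a \<star> a) = ev (inv\<^bsub>BijGroup S\<^esub> a \<star> \<one>\<^bsub>BijGroup S\<^esub>)"
    using a by (intro ev inv_closed one_closed) auto
  thus "inv\<^bsub>BijGroup S\<^esub> a \<in> ?L" using a in_carrier inv_closed by auto
  fix b assume b: "b \<in> ?L"
  have "ev (a \<star> b) = ev (a \<star> \<one>\<^bsub>BijGroup S\<^esub>)"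
    using a b by (intro ev one_closed) auto
  thus "a \<star> b \<in> ?L" using a b in_carrier mult_closed by auto
qed

text \<open>Corestriction after restriction is multiplication by the index, and the index is the
  number of values of \<open>ev\<close>. Correcting n f by the coboundary of v gives a cocycle g
  that vanishes on the subgroup, hence is constant on its left cosets. The sum of g over coset
  representatives then replaces the sum over the whole group.\<close>

lemma transfer_coboundary:
  fixes ev :: "((int \<Rightarrow> int) \<Rightarrow> (int \<Rightarrow> int)) \<Rightarrow> 'b"
  assumes f: "cocycle S H f"
    and ev: "\<And>\<sigma> \<rho> \<rho>'. \<sigma> \<in> H \<Longrightarrow> \<rho> \<in> H \<Longrightarrow> \<rho>' \<in> H \<Longrightarrow> ev \<rho> = ev \<rho>' \<Longrightarrow> ev (\<sigma> \<star> \<rho>) = ev (\<sigma> \<star> \<rho>')"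
    and sub: "multiple_coboundary S {\<sigma> \<in> H. ev \<sigma> = ev \<one>\<^bsub>BijGroup S\<^esub>} n f"
  shows "multiple_coboundary S H (int (card (ev ` H)) * n) f"
proof -
  let ?L = "{\<sigma> \<in> H. ev \<sigma> = ev \<one>\<^bsub>BijGroup S\<^esub>}"
  obtain v where v: "v \<in> S" "\<And>\<sigma> k. \<sigma> \<in> ?L \<Longrightarrow> n * f \<sigma> k = \<sigma> v k - v k"
    using sub unfolding multiple_coboundary_def by blast
  define g where "g \<sigma> = (\<lambda>k. n * f \<sigma> k - (\<sigma> v k - v k))" for \<sigma>
  have fS: "\<And>\<sigma>. \<sigma> \<in> H \<Longrightarrow> f \<sigma> \<in> S" using f by (auto simp: cocycle_def)
  have gS: "g \<sigma> \<in> S" if "\<sigma> \<in> H" for \<sigma>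
    unfolding g_def
    by (rule minus_closed[OF times_closed[OF fS[OF that]] minus_closed[OF act_closed[OF that v(1)] v(1)]])
  have gmul: "g (\<sigma> \<star> \<rho>) = (\<lambda>k. g \<sigma> k + \<sigma> (g \<rho>) k)" if s: "\<sigma> \<in> H" and r: "\<rho> \<in> H" for \<sigma> \<rho>
  proof -
    have eq: "\<sigma> (g \<rho>) = (\<lambda>k. n * \<sigma> (f \<rho>) k - (\<sigma> (\<rho> v) k - \<sigma> v k))"
      unfolding g_def act_minus[OF s times_closed[OF fS[OF r], of n] minus_closed[OF act_closed[OF r v(1)] v(1)]]
        act_minus[OF s act_closed[OF r v(1)] v(1)] act_times[OF s fS[OF r]] ..
    have fm: "f (\<sigma> \<star> \<rho>) = (\<lambda>k. f \<sigma> k + \<sigma> (f \<rho>) k)"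
      using f s r unfolding cocycle_def by blast
    show ?thesis unfolding eq unfolding g_def fm mult_act[OF s r v(1)]
      by (simp add: algebra_simps)
  qed
  have g0: "g \<sigma> = (\<lambda>_. 0)" if "\<sigma> \<in> ?L" for \<sigma>
    using v(2)[OF that] by (simp add: g_def fun_eq_iff)
  have gev: "g \<rho> = g \<rho>'" if r: "\<rho> \<in> H" "\<rho>' \<in> H" "ev \<rho> = ev \<rho>'" for \<rho> \<rho>'
  proof -
    let ?\<tau> = "inv\<^bsub>BijGroup S\<^esub> \<rho>' \<star> \<rho>"
    have "ev ?\<tau> = ev (inv\<^bsub>BijGroup S\<^esub> \<rho>' \<star> \<rho>')" using r by (intro ev inv_closed)
    hence t: "?\<tau> \<in> ?L" using r in_carrier mult_closed inv_closed by auto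
    have "\<rho> = \<rho>' \<star> ?\<tau>" using r in_carrier by (simp add: B.m_assoc[symmetric])
    hence "g \<rho> = (\<lambda>k. g \<rho>' k + \<rho>' (g ?\<tau>) k)" using gmul[of \<rho>' ?\<tau>] r t by auto
    thus ?thesis using g0[OF t] act_zero r by simp
  qed
  define r where "r y = (SOME \<rho>. \<rho> \<in> H \<and> ev \<rho> = y)" for y
  have r: "r y \<in> H" "ev (r y) = y" if "y \<in> ev ` H" for y
    using that someI_ex[of "\<lambda>\<rho>. \<rho> \<in> H \<and> ev \<rho> = y"] unfolding r_def by auto
  define w where "w = (\<lambda>k. \<Sum>y\<in>ev ` H. g (r y) k)"
  have wS: "w \<in> S" unfolding w_def by (rule sum_closed) (simp add: gS r)
  have key: "w k = int (card (ev ` H)) * g \<sigma> k + \<sigma> w k" if s: "\<sigma> \<in> H" for \<sigma> k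
  proof -
    let ?t = "\<lambda>y. ev (\<sigma> \<star> r y)"
    have "inj_on ?t (ev ` H)"
    proof (rule inj_onI)
      fix y z assume yz: "y \<in> ev ` H" "z \<in> ev ` H" and eq: "?t y = ?t z"
      have "ev (inv\<^bsub>BijGroup S\<^esub> \<sigma> \<star> (\<sigma> \<star> r y)) = ev (inv\<^bsub>BijGroup S\<^esub> \<sigma> \<star> (\<sigma> \<star> r z))"
        by (rule ev[OF inv_closed[OF s] mult_closed[OF s r(1)[OF yz(1)]] mult_closed[OF s r(1)[OF yz(2)]] eq])
      moreover have "inv\<^bsub>BijGroup S\<^esub> \<sigma> \<star> (\<sigma> \<star> \<rho>) = \<rho>" if "\<rho> \<in> H" for \<rho>
        using B.m_assoc[of "inv\<^bsub>BijGroup S\<^esub> \<sigma>" \<sigma> \<rho>] s that in_carrier by simp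
      ultimately show "y = z" using r yz by metis
    qed
    moreover have "?t ` ev ` H \<subseteq> ev ` H" using s r mult_closed by auto
    ultimately have bij: "bij_betw ?t (ev ` H) (ev ` H)"
      by (simp add: bij_betw_def endo_inj_surj finite_H)
    have "w k = (\<Sum>y\<in>ev ` H. g (r (?t y)) k)"
      unfolding w_def by (rule sum.reindex_bij_betw[OF bij, symmetric])
    also have "\<dots> = (\<Sum>y\<in>ev ` H. g (\<sigma> \<star> r y) k)"
    proof (rule sum.cong[OF refl])
      fix y assume y: "y \<in> ev ` H"
      have "\<sigma> \<star> r y \<in> H" using y r s mult_closed by auto
      thus "g (r (?t y)) k = g (\<sigma> \<star> r y) k"
        using gev[of "r (?t y)" "\<sigma> \<star> r y"] r[of "?t y"] by auto
    qed
    also have "\<dots> = (\<Sum>y\<in>ev ` H. g \<sigma> k + \<sigma> (g (r y)) k)"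
      using s r gmul by (intro sum.cong) auto
    also have "\<dots> = int (card (ev ` H)) * g \<sigma> k + \<sigma> w k"
      using act_sum[of \<sigma> "ev ` H" "\<lambda>y. g (r y)"] s r gS by (simp add: sum.distrib w_def)
    finally show ?thesis .
  qed
  let ?c = "int (card (ev ` H))"
  \<comment> \<open>\<open>key\<close> reads ?c g \<sigma> = w - \<sigma> w; inserting the
    definition of g and solving for ?c n f \<sigma> leads to this vector.\<close>
  define u where "u = (\<lambda>k. ?c * v k - w k)"
  have uS: "u \<in> S" unfolding u_def using v(1) wS by (intro minus_closed times_closed)
  have "?c * n * f \<sigma> k = \<sigma> u k - u k" if s: "\<sigma> \<in> H" for \<sigma> k
  proof -
    have "\<sigma> u = (\<lambda>k. ?c * \<sigma> v k - \<sigma> w k)"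
      unfolding u_def act_minus[OF s times_closed[OF v(1), of ?c] wS] act_times[OF s v(1)] ..
    thus ?thesis using key[OF s, of k] by (simp add: u_def g_def algebra_simps)
  qed
  thus ?thesis unfolding multiple_coboundary_def using uS by blast
qed

lemma coprime_coboundary:
  assumes "multiple_coboundary S H m f" "multiple_coboundary S H n f" "coprime m n"
  shows "multiple_coboundary S H 1 f"
proof -
  obtain a b where ab: "a * m + b * n = 1"
    using assms(3) bezout_int[of m n] by auto
  obtain u v where u: "u \<in> S" "\<And>\<sigma> k. \<sigma> \<in> H \<Longrightarrow> m * f \<sigma> k = \<sigma> u k - u k"
    and v: "v \<in> S" "\<And>\<sigma> k. \<sigma> \<in> H \<Longrightarrow> n * f \<sigma> k = \<sigma> v k - v k"
    using assms(1,2) unfolding multiple_coboundary_def by metis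
  let ?z = "\<lambda>k. a * u k + b * v k"
  have "1 * f \<sigma> k = \<sigma> ?z k - ?z k" if s: "\<sigma> \<in> H" for \<sigma> k
  proof -
    have "f \<sigma> k = a * (m * f \<sigma> k) + b * (n * f \<sigma> k)"
      using arg_cong[OF ab, of "\<lambda>t. t * f \<sigma> k"] by (simp add: algebra_simps)
    moreover have "\<sigma> ?z k = a * \<sigma> u k + b * \<sigma> v k"
      using act_plus[OF s times_closed[OF u(1), of a] times_closed[OF v(1), of b]]
        act_times[OF s u(1), of a] act_times[OF s v(1), of b] by simp
    ultimately show ?thesis by (simp add: u(2)[OF s] v(2)[OF s] algebra_simps)
  qed
  thus ?thesis unfolding multiple_coboundary_def using u v plus_closed times_closed by blast
qed

end

section \<open>The action of signed permutations in coordinates\<close>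

text \<open>The coordinates \<open>x\<^sub>-\<^sub>1\<close>, \<open>x\<^sub>1, \<dots>, x\<^sub>M\<close> and \<open>deg x\<close> determine \<open>x\<close>.  As \<open>deg\<close> is invariant,
  the complicated \<open>l\<^sub>0\<close>-coefficients of the action never have to be composed.\<close>

definition deg :: "nat \<Rightarrow> (int \<Rightarrow> int) \<Rightarrow> int" where
  "deg M x = 2 * x 0 + (\<Sum>k\<in>{1..int M}. x k)"

text \<open>The value - x_{-1} - x_{\<tau> k} at a flipped k has two sources: the image of l_{-1}
  contains - l_k, and l_{\<tau> k} goes to l_0 - l_k. Coordinates are pulled back along \<tau>,
  whereas basis vectors move by its inverse.\<close>

definition sgn_act :: "nat \<Rightarrow> ((int \<Rightarrow> int) \<Rightarrow> (int \<Rightarrow> int)) \<Rightarrow> (int \<Rightarrow> bool) \<Rightarrow> (int \<Rightarrow> int) \<Rightarrow> bool" where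
  "sgn_act M \<sigma> s \<tau> \<longleftrightarrow> (\<forall>x\<in>lat M. \<sigma> x \<in> lat M \<and> \<sigma> x (-1) = x (-1) \<and> deg M (\<sigma> x) = deg M x \<and>
     (\<forall>k\<in>{1..int M}. \<sigma> x k = (if s k then - x (-1) - x (\<tau> k) else x (\<tau> k))))"

lemma sgn_actD:
  assumes "sgn_act M \<sigma> s \<tau>" "x \<in> lat M"
  shows "\<sigma> x \<in> lat M" "\<sigma> x (-1) = x (-1)" "deg M (\<sigma> x) = deg M x"
    "k \<in> {1..int M} \<Longrightarrow> \<sigma> x k = (if s k then - x (-1) - x (\<tau> k) else x (\<tau> k))"
  using assms unfolding sgn_act_def by blast+

lemma sgn_act_cong:
  assumes "sgn_act M \<sigma> s \<tau>" "\<And>k. k \<in> {1..int M} \<Longrightarrow> s k = s' k \<and> \<tau> k = \<tau>' k"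
  shows "sgn_act M \<sigma> s' \<tau>'"
  using assms unfolding sgn_act_def by simp

lemma lat_zero: "(\<lambda>_. 0) \<in> lat M"
  and lat_plus: "x \<in> lat M \<Longrightarrow> y \<in> lat M \<Longrightarrow> (\<lambda>k. x k + y k) \<in> lat M"
  and lat_uminus: "x \<in> lat M \<Longrightarrow> (\<lambda>k. - x k) \<in> lat M"
  and lb_in_lat: "-1 \<le> i \<Longrightarrow> i \<le> int M \<Longrightarrow> lb i \<in> lat M"
  by (auto simp: lat_def lb_def)

lemma lat_eqI:
  assumes x: "x \<in> lat M" and y: "y \<in> lat M" and m: "x (-1) = y (-1)" and d: "deg M x = deg M y"
    and k: "\<And>k. k \<in> {1..int M} \<Longrightarrow> x k = y k"
  shows "x = y"
proof
  fix i
  have "(\<Sum>k\<in>{1..int M}. x k) = (\<Sum>k\<in>{1..int M}. y k)" using k by (rule sum.cong[OF refl])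
  hence 0: "x 0 = y 0" using d by (simp add: deg_def)
  consider "i < -1" | "i = -1" | "i = 0" | "i \<in> {1..int M}" | "i > int M" by fastforce
  thus "x i = y i" using x y m k 0 by cases (auto simp: lat_def)
qed

lemma deg_plus: "deg M (\<lambda>k. x k + y k) = deg M x + deg M y"
  by (simp add: deg_def sum.distrib)

lemma sgn_act_plus:
  assumes "sgn_act M \<sigma> s \<tau>" "x \<in> lat M" "y \<in> lat M"
  shows "\<sigma> (\<lambda>k. x k + y k) = (\<lambda>k. \<sigma> x k + \<sigma> y k)"
proof (rule lat_eqI[where M = M])
  note a = sgn_actD[OF assms(1)] and l = lat_plus[OF assms(2,3)]
  show "\<sigma> (\<lambda>k. x k + y k) \<in> lat M" by (rule a(1)[OF l])
  show "(\<lambda>k. \<sigma> x k + \<sigma> y k) \<in> lat M" by (intro lat_plus a(1) assms)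
  show "\<sigma> (\<lambda>k. x k + y k) (-1) = \<sigma> x (-1) + \<sigma> y (-1)"
    by (simp add: a(2)[OF l] a(2)[OF assms(2)] a(2)[OF assms(3)])
  show "deg M (\<sigma> (\<lambda>k. x k + y k)) = deg M (\<lambda>k. \<sigma> x k + \<sigma> y k)"
    by (simp add: a(3)[OF l] a(3)[OF assms(2)] a(3)[OF assms(3)] deg_plus)
  fix k assume k: "k \<in> {1..int M}"
  show "\<sigma> (\<lambda>k. x k + y k) k = \<sigma> x k + \<sigma> y k"
    by (simp add: a(4)[OF l k] a(4)[OF assms(2) k] a(4)[OF assms(3) k])
qed

text \<open>Because of the pullback, the permutation of the outer map is applied first. Two flips
  cancel since x_{-1} is invariant.\<close>

lemma sgn_act_compose:
  assumes s: "sgn_act M \<sigma> s \<tau>" and r: "sgn_act M \<rho> s' \<tau>'"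
    and t: "\<And>k. k \<in> {1..int M} \<Longrightarrow> \<tau> k \<in> {1..int M}"
  shows "sgn_act M (compose (lat M) \<sigma> \<rho>) (\<lambda>k. s k \<noteq> s' (\<tau> k)) (\<lambda>k. \<tau>' (\<tau> k))"
  unfolding sgn_act_def
proof (intro ballI conjI)
  fix x assume x: "x \<in> lat M"
  note rx = sgn_actD[OF r x]
  note sx = sgn_actD[OF s rx(1)]
  have c: "compose (lat M) \<sigma> \<rho> x = \<sigma> (\<rho> x)" using x by (simp add: compose_def)
  show "compose (lat M) \<sigma> \<rho> x \<in> lat M" "compose (lat M) \<sigma> \<rho> x (-1) = x (-1)"
    "deg M (compose (lat M) \<sigma> \<rho> x) = deg M x"
    using c rx(1-3) sx(1-3) by auto
  fix k assume k: "k \<in> {1..int M}"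
  show "compose (lat M) \<sigma> \<rho> x k =
    (if s k \<noteq> s' (\<tau> k) then - x (-1) - x (\<tau>' (\<tau> k)) else x (\<tau>' (\<tau> k)))"
    using rx(2) rx(4)[OF t[OF k]] sx(4)[OF k] by (simp add: c)
qed

lemma sgn_act_id:
  assumes "sgn_act M \<sigma> s \<tau>" "\<And>k. k \<in> {1..int M} \<Longrightarrow> \<not> s k \<and> \<tau> k = k" "x \<in> lat M"
  shows "\<sigma> x = x"
  using assms(2,3) sgn_actD[OF assms(1,3)] by (intro lat_eqI[where M = M]) auto

text \<open>Elements of the group are bare maps of the lattice, so signs and permutation have to be
  recovered from images of basis vectors. Coordinate k of the image of l_{-1} is -1 at a flip and 0
  otherwise; coordinate k of the image of l_v is nonzero only for v = \<tau> k.\<close>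

definition flip_of :: "((int \<Rightarrow> int) \<Rightarrow> (int \<Rightarrow> int)) \<Rightarrow> int \<Rightarrow> bool" where
  "flip_of \<sigma> k \<longleftrightarrow> \<sigma> (lb (-1)) k \<noteq> 0"

definition perm_of :: "nat \<Rightarrow> ((int \<Rightarrow> int) \<Rightarrow> (int \<Rightarrow> int)) \<Rightarrow> int \<Rightarrow> int" where
  "perm_of M \<sigma> k = (THE v. v \<in> {1..int M} \<and> \<sigma> (lb v) k \<noteq> 0)"

lemma sgn_act_unique:
  assumes "sgn_act M \<sigma> s \<tau>" "k \<in> {1..int M}" "\<tau> k \<in> {1..int M}"
  shows "flip_of \<sigma> k = s k" "perm_of M \<sigma> k = \<tau> k"
proof -
  have "lb (-1) (\<tau> k) = 0" using assms(3) by (simp add: lb_def)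
  thus "flip_of \<sigma> k = s k"
    using sgn_actD(4)[OF assms(1) lb_in_lat assms(2), of "-1"]
    by (simp add: flip_of_def lb_def)
  have "\<sigma> (lb v) k \<noteq> 0 \<longleftrightarrow> v = \<tau> k" if "v \<in> {1..int M}" for v
    using sgn_actD(4)[OF assms(1) lb_in_lat assms(2), of v] that by (simp add: lb_def)
  thus "perm_of M \<sigma> k = \<tau> k" using assms(3) by (auto simp: perm_of_def)
qed

text \<open>The only place where the formula for \<Phi> on the basis is unfolded; afterwards
  \<open>sgn_act\<close> is all that is known about a generator.\<close>

lemma Phi_sgn_act:
  assumes J: "J \<subseteq> {1..int M}" "even (card J)" and t: "bij_betw \<tau> {1..int M} {1..int M}"
  shows "sgn_act M (restrict (Phi M (J, \<tau>)) (lat M)) (\<lambda>k. k \<in> J) \<tau>"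
  unfolding sgn_act_def
proof (intro ballI)
  let ?I = "{1..int M}"
  have fJ: "finite J" using J(1) by (rule finite_subset) simp
  have t_in: "\<tau> k \<in> ?I" if "k \<in> ?I" for k using t that by (rule bij_betwE[rule_format])
  have inv: "inv_into ?I \<tau> (\<tau> k) = k" if "k \<in> ?I" for k
    using t that by (simp add: bij_betw_inv_into_left)
  fix x assume x: "x \<in> lat M"
  let ?y = "Phi M (J, \<tau>) x"
  have I: "{-1..int M} = insert (-1) (insert 0 ?I)" by auto
  have y: "?y k = x (-1) * (lb (-1) k + int (card J) div 2 * lb 0 k - (\<Sum>j\<in>J. lb j k)) + x 0 * lb 0 k
      + (\<Sum>j\<in>?I. x (\<tau> j) * (if j \<notin> J then lb j k else lb 0 k - lb j k))" for k
  proof -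
    have "(\<Sum>i\<in>?I. x i * phi_basis M (J, \<tau>) i k) = (\<Sum>j\<in>?I. x (\<tau> j) * phi_basis M (J, \<tau>) (\<tau> j) k)"
      by (rule sum.reindex_bij_betw[OF t, symmetric])
    also have "\<dots> = (\<Sum>j\<in>?I. x (\<tau> j) * (if j \<notin> J then lb j k else lb 0 k - lb j k))"
    proof (rule sum.cong[OF refl])
      fix j assume j: "j \<in> ?I"
      have "\<tau> j \<noteq> 0" "\<tau> j \<noteq> -1" using t_in[OF j] by auto
      thus "x (\<tau> j) * phi_basis M (J, \<tau>) (\<tau> j) k = x (\<tau> j) * (if j \<notin> J then lb j k else lb 0 k - lb j k)"
        using inv[OF j] by (simp add: phi_basis_def)
    qed
    finally show ?thesis by (simp add: Phi_def I) (simp add: phi_basis_def)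
  qed
  have sJ: "(\<Sum>j\<in>J. lb j k) = (if k \<in> J then 1 else 0)" for k
    using fJ by (simp add: lb_def sum.If_cases)
  have ym: "?y (-1) = x (-1)" and y0: "?y 0 = x 0 + int (card J) div 2 * x (-1) + (\<Sum>j\<in>?I. if j \<in> J then x (\<tau> j) else 0)"
    unfolding y sJ using J by (auto simp: lb_def intro!: sum.neutral sum.cong)
  have yk: "?y k = (if k \<in> J then - x (-1) - x (\<tau> k) else x (\<tau> k))" if k: "k \<in> ?I" for k
  proof -
    have "(\<Sum>j\<in>?I. x (\<tau> j) * (if j \<notin> J then lb j k else lb 0 k - lb j k))
        = (\<Sum>j\<in>?I. if j = k then (if k \<in> J then - x (\<tau> k) else x (\<tau> k)) else 0)"
      using k by (intro sum.cong) (auto simp: lb_def)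
    thus ?thesis unfolding y sJ using k by (simp add: lb_def)
  qed
  have "deg M ?y = deg M x"
  proof -
    have "(\<Sum>k\<in>?I. ?y k) + 2 * (\<Sum>j\<in>?I. if j \<in> J then x (\<tau> j) else 0)
        = (\<Sum>k\<in>?I. x (\<tau> k) - (if k \<in> J then x (-1) else 0))"
      by (simp add: sum_distrib_left sum.distrib[symmetric] yk)
        (rule sum.cong, auto)
    also have "\<dots> = (\<Sum>k\<in>?I. x (\<tau> k)) - int (card J) * x (-1)"
      using J(1) by (simp add: sum_subtractf sum.If_cases Int_absorb1)
    also have "(\<Sum>k\<in>?I. x (\<tau> k)) = (\<Sum>k\<in>?I. x k)" by (rule sum.reindex_bij_betw[OF t])
    finally have "(\<Sum>k\<in>?I. ?y k) + 2 * (\<Sum>j\<in>?I. if j \<in> J then x (\<tau> j) else 0)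
        = (\<Sum>k\<in>?I. x k) - int (card J) * x (-1)" .
    \<comment> \<open>Evenness makes the \<open>div 2\<close> in the image of l_{-1} exact. Its
      contribution card J times x_{-1} to the degree cancels the same amount lost by the flipped
      coordinates.\<close>
    moreover obtain c where "int (card J) = 2 * c" using J(2) by (auto elim: evenE)
    ultimately show ?thesis by (simp add: deg_def y0 algebra_simps)
  qed
  moreover have "?y \<in> lat M"
    unfolding lat_def mem_Collect_eq y sJ using J(1) by (auto simp: lb_def intro!: sum.neutral)
  ultimately show "restrict (Phi M (J, \<tau>)) (lat M) x \<in> lat M \<and>
      restrict (Phi M (J, \<tau>)) (lat M) x (-1) = x (-1) \<and>
      deg M (restrict (Phi M (J, \<tau>)) (lat M) x) = deg M x \<and>
      (\<forall>k\<in>?I. restrict (Phi M (J, \<tau>)) (lat M) x k = (if k \<in> J then - x (-1) - x (\<tau> k) else x (\<tau> k)))"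
    using x ym yk by simp
qed

lemma Phi_in_BijGroup:
  assumes J: "J \<subseteq> {1..int M}" "even (card J)" and t: "bij_betw \<tau> {1..int M} {1..int M}"
  shows "restrict (Phi M (J, \<tau>)) (lat M) \<in> carrier (BijGroup (lat M))"
proof -
  let ?I = "{1..int M}"
  define \<tau>' J' where "\<tau>' = inv_into ?I \<tau>" and "J' = \<tau> ` J"
  have t': "bij_betw \<tau>' ?I ?I" unfolding \<tau>'_def by (rule bij_betw_inv_into[OF t])
  have tin: "\<tau> k \<in> ?I" "\<tau>' k \<in> ?I" if "k \<in> ?I" for k
    using t t' that by (auto simp: bij_betw_def)
  have J': "J' \<subseteq> ?I" unfolding J'_def using J(1) tin(1) by auto
  have "card J' = card J" unfolding J'_def
    using inj_on_subset[OF bij_betw_imp_inj_on[OF t] J(1)] by (rule card_image)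
  hence J'e: "even (card J')" using J(2) by simp
  have inv: "\<tau>' (\<tau> k) = k" "\<tau> (\<tau>' k) = k" if "k \<in> ?I" for k
    using t that unfolding \<tau>'_def by (auto simp: bij_betw_inv_into_left bij_betw_inv_into_right)
  have mem: "\<tau> k \<in> J' \<longleftrightarrow> k \<in> J" if "k \<in> ?I" for k
    using bij_betw_imp_inj_on[OF t] J(1) that unfolding J'_def by (auto dest: inj_onD)
  have mem': "k \<in> J' \<longleftrightarrow> \<tau>' k \<in> J" if "k \<in> ?I" for k
    using mem[OF tin(2)[OF that]] inv(2)[OF that] by simp
  let ?\<sigma> = "restrict (Phi M (J, \<tau>)) (lat M)" and ?\<rho> = "restrict (Phi M (J', \<tau>')) (lat M)"
  have s: "sgn_act M ?\<sigma> (\<lambda>k. k \<in> J) \<tau>" by (rule Phi_sgn_act[OF J t])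
  have r: "sgn_act M ?\<rho> (\<lambda>k. k \<in> J') \<tau>'" by (rule Phi_sgn_act[OF J' J'e t'])
  have "?\<sigma> (?\<rho> x) = x" if x: "x \<in> lat M" for x
    by (subst compose_eq[OF x, of ?\<sigma> ?\<rho>, symmetric])
      (rule sgn_act_id[OF sgn_act_compose[OF s r tin(1)] _ x], use inv mem in auto)
  moreover have "?\<rho> (?\<sigma> x) = x" if x: "x \<in> lat M" for x
    by (subst compose_eq[OF x, of ?\<rho> ?\<sigma>, symmetric])
      (rule sgn_act_id[OF sgn_act_compose[OF r s tin(2)] _ x], use inv mem' in auto)
  ultimately have "bij_betw ?\<sigma> (lat M) (lat M)"
    using sgn_actD(1)[OF s] sgn_actD(1)[OF r] by (intro bij_betw_byWitness[where f' = ?\<rho>]) auto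
  thus ?thesis by (simp add: BijGroup_def Bij_def)
qed

section \<open>Groups acting on two odd blocks and one further index\<close>

definition block1 :: "nat \<Rightarrow> int set" where "block1 N1 = {1..int N1}"

definition block2 :: "nat \<Rightarrow> nat \<Rightarrow> int set" where "block2 N1 N2 = {int N1 + 1..int N1 + int N2}"

text \<open>The extra index belongs to the sign set of the flipping generator of either block, so it
  is flipped exactly when one of the two blocks is.\<close>

definition block_flip :: "nat \<Rightarrow> nat \<Rightarrow> bool \<Rightarrow> bool \<Rightarrow> int \<Rightarrow> bool" where
  "block_flip N1 N2 e1 e2 k =
     (if k \<in> block1 N1 then e1 else if k \<in> block2 N1 N2 then e2 else e1 \<noteq> e2)"

text \<open>What the vanishing argument retains of the affine structure: a map x -> u x + c with u
  different from 1 has at most one fixed point.\<close>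

definition frobenius_on :: "int set \<Rightarrow> (int \<Rightarrow> int) \<Rightarrow> bool \<Rightarrow> bool" where
  "frobenius_on A \<tau> e \<longleftrightarrow> bij_betw \<tau> A A \<and>
     (\<forall>a\<in>A. \<forall>v\<in>A. a \<noteq> v \<longrightarrow> \<tau> a = a \<longrightarrow> \<tau> v = v \<longrightarrow> \<not> e)"

lemma frobenius_on_cong:
  assumes "frobenius_on A \<tau> e" "\<And>k. k \<in> A \<Longrightarrow> \<tau> k = \<tau>' k"
  shows "frobenius_on A \<tau>' e"
  using assms bij_betw_cong[of A \<tau> \<tau>' A] unfolding frobenius_on_def by simp

text \<open>All that the vanishing argument uses about the two families. The assumptions are
  inherited by subgroups, so vanishing of H^1 for every instance already yields the (H1)
  condition.\<close>

locale two_block_action =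
  fixes N1 N2 M :: nat and H :: "((int \<Rightarrow> int) \<Rightarrow> (int \<Rightarrow> int)) set"
  assumes M_def: "M = N1 + N2 + 1" and odd_N1: "odd N1" and odd_N2: "odd N2"
    and subgroup_lat: "subgroup H (BijGroup (lat M))"
    and finite_group: "finite H"
    and block_act: "\<And>\<sigma>. \<sigma> \<in> H \<Longrightarrow> \<exists>\<tau> e1 e2. sgn_act M \<sigma> (block_flip N1 N2 e1 e2) \<tau> \<and>
          frobenius_on (block1 N1) \<tau> e1 \<and> frobenius_on (block2 N1 N2) \<tau> e2 \<and> \<tau> (int M) = int M"
begin

abbreviation "A1 \<equiv> block1 N1"
abbreviation "A2 \<equiv> block2 N1 N2"
abbreviation "perm \<sigma> \<equiv> perm_of M \<sigma>"
text \<open>A block is flipped as a whole, so its sign can be read at its first index.\<close>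

abbreviation "e1 \<sigma> \<equiv> flip_of \<sigma> 1"
abbreviation "e2 \<sigma> \<equiv> flip_of \<sigma> (int N1 + 1)"

lemma I_split: "{1..int M} = insert (int M) (A1 \<union> A2)"
  by (auto simp: block1_def block2_def M_def)

lemma blocks_disjoint: "A1 \<inter> A2 = {}" "int M \<notin> A1" "int M \<notin> A2"
  by (auto simp: block1_def block2_def M_def)

lemma first_in_blocks: "1 \<in> A1" "int N1 + 1 \<in> A2"
  using odd_N1 odd_N2 by (auto simp: block1_def block2_def elim!: oddE)

lemma act:
  assumes "\<sigma> \<in> H"
  shows "sgn_act M \<sigma> (block_flip N1 N2 (e1 \<sigma>) (e2 \<sigma>)) (perm \<sigma>)"
    and "frobenius_on A1 (perm \<sigma>) (e1 \<sigma>)" and "frobenius_on A2 (perm \<sigma>) (e2 \<sigma>)"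
    and "perm \<sigma> (int M) = int M"
proof -
  obtain \<tau> a b where t: "sgn_act M \<sigma> (block_flip N1 N2 a b) \<tau>"
    "frobenius_on A1 \<tau> a" "frobenius_on A2 \<tau> b" "\<tau> (int M) = int M"
    using block_act[OF assms] by blast
  have t_in: "\<tau> k \<in> {1..int M}" if "k \<in> {1..int M}" for k
    using that t(2-4) unfolding I_split frobenius_on_def by (auto simp: bij_betw_def)
  have p: "perm \<sigma> k = \<tau> k" and f: "flip_of \<sigma> k = block_flip N1 N2 a b k" if "k \<in> {1..int M}" for k
    using sgn_act_unique[OF t(1) that t_in[OF that]] by auto
  have 1: "1 \<in> {1..int M}" "int N1 + 1 \<in> {1..int M}" using first_in_blocks unfolding I_split by auto
  have e: "e1 \<sigma> = a" "e2 \<sigma> = b"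
    using f[OF 1(1)] f[OF 1(2)] first_in_blocks blocks_disjoint by (auto simp: block_flip_def)
  show "sgn_act M \<sigma> (block_flip N1 N2 (e1 \<sigma>) (e2 \<sigma>)) (perm \<sigma>)"
    unfolding e by (rule sgn_act_cong[OF t(1)]) (simp add: p)
  show "frobenius_on A1 (perm \<sigma>) (e1 \<sigma>)"
    unfolding e by (rule frobenius_on_cong[OF t(2)]) (simp add: p I_split)
  show "frobenius_on A2 (perm \<sigma>) (e2 \<sigma>)"
    unfolding e by (rule frobenius_on_cong[OF t(3)]) (simp add: p I_split)
  show "perm \<sigma> (int M) = int M" using t(4) p by (simp add: I_split)
qed

lemma perm_bij:
  assumes "\<sigma> \<in> H"
  shows "bij_betw (perm \<sigma>) A1 A1" "bij_betw (perm \<sigma>) A2 A2" "bij_betw (perm \<sigma>) {1..int M} {1..int M}"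
proof -
  show 1: "bij_betw (perm \<sigma>) A1 A1" "bij_betw (perm \<sigma>) A2 A2"
    using act(2,3)[OF assms] by (auto simp: frobenius_on_def)
  have "bij_betw (perm \<sigma>) ({int M} \<union> (A1 \<union> A2)) ({int M} \<union> (A1 \<union> A2))"
    using blocks_disjoint act(4)[OF assms] by (intro bij_betw_combine 1) auto
  thus "bij_betw (perm \<sigma>) {1..int M} {1..int M}" unfolding I_split by simp
qed

lemma perm_in:
  assumes "\<sigma> \<in> H"
  shows "k \<in> A1 \<Longrightarrow> perm \<sigma> k \<in> A1" "k \<in> A2 \<Longrightarrow> perm \<sigma> k \<in> A2"
    "k \<in> {1..int M} \<Longrightarrow> perm \<sigma> k \<in> {1..int M}"
  using perm_bij[OF assms] by (auto simp: bij_betw_def)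

sublocale lattice_action "lat M" H
proof (rule lattice_action.intro)
  show "(\<lambda>_. 0) \<in> lat M" by (rule lat_zero)
  show "(\<lambda>k. x k + y k) \<in> lat M" if "x \<in> lat M" "y \<in> lat M" for x y using that by (rule lat_plus)
  show "(\<lambda>k. - x k) \<in> lat M" if "x \<in> lat M" for x using that by (rule lat_uminus)
  show "\<sigma> (\<lambda>k. x k + y k) = (\<lambda>k. \<sigma> x k + \<sigma> y k)" if "\<sigma> \<in> H" "x \<in> lat M" "y \<in> lat M" for \<sigma> x y
    using sgn_act_plus[OF act(1)[OF that(1)] that(2,3)] .
qed (rule subgroup_lat, rule finite_group)

lemma mult_eq_compose: "\<sigma> \<in> H \<Longrightarrow> \<rho> \<in> H \<Longrightarrow> \<sigma> \<otimes>\<^bsub>BijGroup (lat M)\<^esub> \<rho> = compose (lat M) \<sigma> \<rho>"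
  using in_Bij by (simp add: BijGroup_def)

text \<open>The signs add because \<open>perm \<sigma>\<close> preserves each block; the
  permutations compose in reverse order because they act by pullback.\<close>

lemma act_mult:
  assumes s: "\<sigma> \<in> H" and r: "\<rho> \<in> H"
  defines "\<pi> \<equiv> \<sigma> \<otimes>\<^bsub>BijGroup (lat M)\<^esub> \<rho>"
  shows "k \<in> {1..int M} \<Longrightarrow> perm \<pi> k = perm \<rho> (perm \<sigma> k)"
    and "e1 \<pi> \<longleftrightarrow> e1 \<sigma> \<noteq> e1 \<rho>" and "e2 \<pi> \<longleftrightarrow> e2 \<sigma> \<noteq> e2 \<rho>"
proof -
  have a: "sgn_act M \<pi> (\<lambda>k. block_flip N1 N2 (e1 \<sigma>) (e2 \<sigma>) k \<noteq> block_flip N1 N2 (e1 \<rho>) (e2 \<rho>) (perm \<sigma> k))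
      (\<lambda>k. perm \<rho> (perm \<sigma> k))"
    unfolding \<pi>_def mult_eq_compose[OF s r] by (rule sgn_act_compose[OF act(1)[OF s] act(1)[OF r] perm_in(3)[OF s]])
  note u = sgn_act_unique[OF a _ perm_in(3)[OF r perm_in(3)[OF s]]]
  show "perm \<pi> k = perm \<rho> (perm \<sigma> k)" if "k \<in> {1..int M}" using u(2) that by blast
  have 1: "1 \<in> {1..int M}" "int N1 + 1 \<in> {1..int M}" using first_in_blocks unfolding I_split by auto
  show "e1 \<pi> \<longleftrightarrow> e1 \<sigma> \<noteq> e1 \<rho>" "e2 \<pi> \<longleftrightarrow> e2 \<sigma> \<noteq> e2 \<rho>"
    using u(1)[OF 1(1) 1(1)] u(1)[OF 1(2) 1(2)] first_in_blocks perm_in[OF s] blocks_disjoint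
    by (auto simp: block_flip_def)
qed

lemma act_one:
  defines "\<pi> \<equiv> \<one>\<^bsub>BijGroup (lat M)\<^esub>"
  shows "k \<in> {1..int M} \<Longrightarrow> perm \<pi> k = k" and "\<not> e1 \<pi>" and "\<not> e2 \<pi>"
proof -
  have a: "sgn_act M \<pi> (\<lambda>_. False) id"
    by (simp add: \<pi>_def BijGroup_def sgn_act_def)
  show "perm \<pi> k = k" if "k \<in> {1..int M}" using sgn_act_unique(2)[OF a that] that by simp
  have 1: "1 \<in> {1..int M}" "int N1 + 1 \<in> {1..int M}" using first_in_blocks unfolding I_split by auto
  show "\<not> e1 \<pi>" "\<not> e2 \<pi>"
    using sgn_act_unique(1)[OF a 1(1)] sgn_act_unique(1)[OF a 1(2)] 1 by auto
qed

lemma two_block_subgroup: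
  assumes "subgroup L (BijGroup (lat M))" "L \<subseteq> H"
  shows "two_block_action N1 N2 M L"
proof (rule two_block_action.intro)
  show "\<exists>\<tau> e1 e2. sgn_act M \<sigma> (block_flip N1 N2 e1 e2) \<tau> \<and>
          frobenius_on (block1 N1) \<tau> e1 \<and> frobenius_on (block2 N1 N2) \<tau> e2 \<and> \<tau> (int M) = int M"
    if "\<sigma> \<in> L" for \<sigma>
    using subsetD[OF assms(2) that] by (rule block_act)
qed (use M_def odd_N1 odd_N2 assms finite_group finite_subset in auto)

text \<open>Without flips every coordinate function is carried to a coordinate function. For x_0
  this follows from the invariance of \<open>deg\<close> and of the sum of the x_k.\<close>

lemma coboundary_of_unflipped:
  assumes f: "cocycle (lat M) H f" and unflipped: "\<And>\<sigma>. \<sigma> \<in> H \<Longrightarrow> \<not> e1 \<sigma> \<and> \<not> e2 \<sigma>"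
  shows "multiple_coboundary (lat M) H 1 f"
proof (rule permutation_coboundary[OF f, where X = "{-1..int M}" and \<phi> = "\<lambda>i x. x i"])
  fix x y assume xy: "x \<in> lat M" "y \<in> lat M" "\<And>i. i \<in> {-1..int M} \<Longrightarrow> x i = y i"
  show "x = y"
  proof
    fix k
    show "x k = y k" using xy by (cases "k \<in> {-1..int M}") (auto simp: lat_def)
  qed
next
  fix q
  show "\<exists>x\<in>lat M. \<forall>i\<in>{-1..int M}. x i = q i"
    by (rule bexI[where x = "\<lambda>k. if k \<in> {-1..int M} then q k else 0"]) (auto simp: lat_def)
next
  fix \<sigma> i assume s: "\<sigma> \<in> H" and i: "i \<in> {-1..int M}"
  have k: "\<sigma> x k = x (perm \<sigma> k)" if "x \<in> lat M" "k \<in> {1..int M}" for x k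
    using sgn_actD(4)[OF act(1)[OF s] that] unflipped[OF s] by (simp add: block_flip_def)
  have 0: "\<sigma> x 0 = x 0" if x: "x \<in> lat M" for x
  proof -
    have "(\<Sum>k\<in>{1..int M}. \<sigma> x k) = (\<Sum>k\<in>{1..int M}. x (perm \<sigma> k))"
      using k[OF x] by (rule sum.cong[OF refl])
    also have "\<dots> = (\<Sum>k\<in>{1..int M}. x k)" by (rule sum.reindex_bij_betw[OF perm_bij(3)[OF s]])
    finally show ?thesis using sgn_actD(3)[OF act(1)[OF s] x] by (simp add: deg_def)
  qed
  consider "i = -1" | "i = 0" | "i \<in> {1..int M}" using i by fastforce
  thus "\<exists>j\<in>{-1..int M}. \<forall>x\<in>lat M. \<sigma> x i = x j"
  proof cases
    case 3
    thus ?thesis using k perm_in(3)[OF s 3] by (intro bexI[where x = "perm \<sigma> i"]) auto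
  next
    case 1
    thus ?thesis using sgn_actD(2)[OF act(1)[OF s]] i by blast
  next
    case 2
    thus ?thesis using 0 i by blast
  qed
qed simp

section \<open>The flip-free subgroup and the stabilisers of odd index\<close>

text \<open>The pair of block signs is a homomorphism to (Z/2)^2 with flip-free kernel. The index of
  the kernel is the size of the image, and a subset of (Z/2)^2 that contains 0 and is closed under
  addition has 1, 2 or 4 elements.\<close>

lemma coboundary_power_of_2:
  assumes f: "cocycle (lat M) H f"
  shows "\<exists>c\<in>{1, 2, 4}. multiple_coboundary (lat M) H c f"
proof -
  define ev where "ev \<sigma> = (e1 \<sigma>, e2 \<sigma>)" for \<sigma>
  let ?L = "{\<sigma> \<in> H. ev \<sigma> = ev \<one>\<^bsub>BijGroup (lat M)\<^esub>}"
  have ev: "ev (\<sigma> \<otimes>\<^bsub>BijGroup (lat M)\<^esub> \<rho>) = ev (\<sigma> \<otimes>\<^bsub>BijGroup (lat M)\<^esub> \<rho>')"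
    if "\<sigma> \<in> H" "\<rho> \<in> H" "\<rho>' \<in> H" "ev \<rho> = ev \<rho>'" for \<sigma> \<rho> \<rho>'
    using that by (simp add: ev_def act_mult)
  have "subgroup ?L (BijGroup (lat M))" by (rule fibre_subgroup) (rule ev)
  then interpret L: two_block_action N1 N2 M ?L by (rule two_block_subgroup) auto
  have "multiple_coboundary (lat M) ?L 1 f"
    using cocycle_subset[OF f, of ?L] act_one(2,3) by (intro L.coboundary_of_unflipped) (auto simp: ev_def)
  hence c: "multiple_coboundary (lat M) H (int (card (ev ` H)) * 1) f"
    by (intro transfer_coboundary[OF f] ev)
  have closed: "(a \<noteq> a', b \<noteq> b') \<in> ev ` H" if ab: "(a, b) \<in> ev ` H" "(a', b') \<in> ev ` H" for a b a' b'
  proof -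
    obtain \<sigma> \<rho> where "\<sigma> \<in> H" "(a, b) = ev \<sigma>" "\<rho> \<in> H" "(a', b') = ev \<rho>" using ab by auto
    hence "ev (\<sigma> \<otimes>\<^bsub>BijGroup (lat M)\<^esub> \<rho>) = (a \<noteq> a', b \<noteq> b')" by (auto simp: ev_def act_mult)
    thus ?thesis using mult_closed[OF \<open>\<sigma> \<in> H\<close> \<open>\<rho> \<in> H\<close>] by (metis imageI)
  qed
  have FF: "(False, False) \<in> ev ` H" using one_closed act_one(2,3) by (force simp: ev_def)
  have "card (ev ` H) \<in> {1, 2, 4}"
  proof -
    have UNIV4: "(UNIV :: (bool \<times> bool) set) = {(False, False), (False, True), (True, False), (True, True)}"
      by (simp add: UNIV_bool flip: UNIV_Times_UNIV)
    have "ev ` H = (\<Union>p\<in>UNIV. if p \<in> ev ` H then {p} else {})" by (auto split: if_splits)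
    hence all: "ev ` H = {(False, False)} \<union> (if (False, True) \<in> ev ` H then {(False, True)} else {})
       \<union> (if (True, False) \<in> ev ` H then {(True, False)} else {})
       \<union> (if (True, True) \<in> ev ` H then {(True, True)} else {})"
      unfolding UNIV4 using FF by (simp only: UN_insert UN_empty if_True Un_empty_right Un_assoc)
    show ?thesis
      using closed[of False True True False] closed[of False True True True] closed[of True False True True]
      by (subst all) auto
  qed
  thus ?thesis using c by auto
qed

text \<open>A set of odd size is not a disjoint union of orbits of even size.\<close>

lemma ex_odd_orbit:
  assumes "finite A" "odd (card A)" "A \<subseteq> {1..int M}" "\<And>\<sigma> k. \<sigma> \<in> H \<Longrightarrow> k \<in> A \<Longrightarrow> perm \<sigma> k \<in> A"
  shows "\<exists>a\<in>A. odd (card {k \<in> A. \<exists>\<sigma>\<in>H. perm \<sigma> k = a})"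
proof -
  define r where "r = {(a, k). a \<in> A \<and> k \<in> A \<and> (\<exists>\<sigma>\<in>H. perm \<sigma> k = a)}"
  have "equiv A r"
  proof (rule equivI)
    show "r \<subseteq> A \<times> A" by (auto simp: r_def)
    show "refl_on A r"
    proof (rule refl_onI)
      fix a assume a: "a \<in> A"
      hence "perm \<one>\<^bsub>BijGroup (lat M)\<^esub> a = a" using assms(3) by (intro act_one(1)) auto
      thus "(a, a) \<in> r" using one_closed a by (auto simp: r_def)
    qed
    show "sym r"
    proof (rule symI)
      fix a k assume "(a, k) \<in> r"
      then obtain \<sigma> where s: "a \<in> A" "k \<in> A" "\<sigma> \<in> H" "perm \<sigma> k = a" by (auto simp: r_def)
      let ?i = "inv\<^bsub>BijGroup (lat M)\<^esub> \<sigma>"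
      have "perm ?i a = perm (\<sigma> \<otimes>\<^bsub>BijGroup (lat M)\<^esub> ?i) k"
        using s assms(3) inv_closed by (subst act_mult(1)) auto
      also have "\<dots> = k"
        using s(2) assms(3) group.r_inv[OF group_BijGroup in_carrier[OF s(3)]] act_one(1)[of k] by auto
      finally show "(k, a) \<in> r" using s inv_closed by (auto simp: r_def)
    qed
    show "trans r"
    proof (rule transI)
      fix a b c assume "(a, b) \<in> r" "(b, c) \<in> r"
      then obtain \<sigma> \<rho> where s: "a \<in> A" "c \<in> A" "\<sigma> \<in> H" "\<rho> \<in> H" "perm \<sigma> b = a" "perm \<rho> c = b"
        by (auto simp: r_def)
      have "perm (\<rho> \<otimes>\<^bsub>BijGroup (lat M)\<^esub> \<sigma>) c = a" using s assms(3) by (subst act_mult(1)) auto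
      thus "(a, c) \<in> r" using s mult_closed by (auto simp: r_def)
    qed
  qed
  then obtain X where X: "X \<in> A // r" "odd (card X)"
    using equiv_imp_dvd_card[OF assms(1), of r 2] assms(2) by auto
  then obtain a where "a \<in> A" "X = r `` {a}" by (auto simp: quotient_def)
  moreover have "r `` {a} = {k \<in> A. \<exists>\<sigma>\<in>H. perm \<sigma> k = a}" using \<open>a \<in> A\<close> by (auto simp: r_def)
  ultimately show ?thesis using X(2) by auto
qed

lemma stabilizer_transfer:
  assumes f: "cocycle (lat M) H f"
    and A: "finite A" "odd (card A)" "A \<subseteq> {1..int M}" "\<And>\<sigma>. \<sigma> \<in> H \<Longrightarrow> bij_betw (perm \<sigma>) A A"
  obtains a L m where "a \<in> A" "L = {\<sigma> \<in> H. perm \<sigma> a = a}" "subgroup L (BijGroup (lat M))" "odd m"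
    "\<And>n. multiple_coboundary (lat M) L n f \<Longrightarrow> multiple_coboundary (lat M) H (m * n) f"
proof -
  have pA: "perm \<sigma> k \<in> A" if "\<sigma> \<in> H" "k \<in> A" for \<sigma> k
    using A(4)[OF that(1)] that(2) by (auto simp: bij_betw_def)
  obtain a where a: "a \<in> A" "odd (card {k \<in> A. \<exists>\<sigma>\<in>H. perm \<sigma> k = a})" (is "odd (card ?O)")
    using ex_odd_orbit[OF A(1-3) pA] by blast
  \<comment> \<open>Since \<open>perm\<close> reverses products, left cosets of the stabiliser are
    separated by the preimage of a and not by its image. The preimage is a single point, and it runs
    through the orbit of a.\<close>
  define ev where "ev \<sigma> = {k \<in> A. perm \<sigma> k = a}" for \<sigma>
  let ?L = "{\<sigma> \<in> H. ev \<sigma> = ev \<one>\<^bsub>BijGroup (lat M)\<^esub>}"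
  have ev: "ev (\<sigma> \<otimes>\<^bsub>BijGroup (lat M)\<^esub> \<rho>) = ev (\<sigma> \<otimes>\<^bsub>BijGroup (lat M)\<^esub> \<rho>')"
    if "\<sigma> \<in> H" "\<rho> \<in> H" "\<rho>' \<in> H" "ev \<rho> = ev \<rho>'" for \<sigma> \<rho> \<rho>'
  proof -
    have "ev (\<sigma> \<otimes>\<^bsub>BijGroup (lat M)\<^esub> \<rho>) = {k \<in> A. perm \<sigma> k \<in> ev \<rho>}" if "\<rho> \<in> H" for \<rho>
      using that \<open>\<sigma> \<in> H\<close> A(3) pA unfolding ev_def by (auto simp: act_mult(1)[OF \<open>\<sigma> \<in> H\<close> that])
    thus ?thesis using that by simp
  qed
  have single: "\<exists>k\<in>A. perm \<sigma> k = a \<and> ev \<sigma> = {k}" if s: "\<sigma> \<in> H" for \<sigma>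
  proof -
    obtain k where k: "k \<in> A" "perm \<sigma> k = a" using A(4)[OF s] a(1) by (force simp: bij_betw_def)
    have "ev \<sigma> = {k}" using k inj_onD[OF bij_betw_imp_inj_on[OF A(4)[OF s]]] by (auto simp: ev_def)
    thus ?thesis using k by blast
  qed
  have "ev ` H = (\<lambda>k. {k}) ` ?O"
  proof (intro equalityI subsetI)
    fix y assume "y \<in> ev ` H"
    then obtain \<sigma> where s: "\<sigma> \<in> H" "y = ev \<sigma>" by blast
    then obtain k where "k \<in> A" "perm \<sigma> k = a" "y = {k}" using single by blast
    thus "y \<in> (\<lambda>k. {k}) ` ?O" using s(1) by blast
  next
    fix y assume "y \<in> (\<lambda>k. {k}) ` ?O"
    then obtain k \<sigma> where k: "k \<in> A" "y = {k}" "\<sigma> \<in> H" "perm \<sigma> k = a" by blast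
    have "k \<in> ev \<sigma>" using k by (simp add: ev_def)
    hence "ev \<sigma> = {k}" using single[OF k(3)] by auto
    thus "y \<in> ev ` H" using k by blast
  qed
  hence "card (ev ` H) = card ?O" by (simp add: card_image)
  hence odd: "odd (int (card (ev ` H)))" using a(2) by simp
  have "ev \<one>\<^bsub>BijGroup (lat M)\<^esub> = {a}" using act_one(1) A(3) a(1) by (auto simp: ev_def)
  moreover have "ev \<sigma> = {a} \<longleftrightarrow> perm \<sigma> a = a" if s: "\<sigma> \<in> H" for \<sigma>
  proof -
    obtain k where k: "ev \<sigma> = {k}" using single[OF s] by blast
    have "perm \<sigma> a = a \<longleftrightarrow> a \<in> ev \<sigma>" using a(1) by (simp add: ev_def)
    thus ?thesis using k by auto
  qed
  ultimately have L: "?L = {\<sigma> \<in> H. perm \<sigma> a = a}" by auto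
  show ?thesis
  proof (rule that[OF a(1) L _ odd])
    show "subgroup ?L (BijGroup (lat M))" by (rule fibre_subgroup) (rule ev)
    show "multiple_coboundary (lat M) H (int (card (ev ` H)) * n) f"
      if "multiple_coboundary (lat M) ?L n f" for n
      by (rule transfer_coboundary[OF f _ that]) (rule ev)
  qed
qed

end

section \<open>Stabilisers of a point in each block\<close>

text \<open>For the stabiliser of \<open>a\<close> and \<open>b\<close>, contracting an invariant choice of fibre components outside
  \<open>a\<close>, \<open>b\<close>, \<open>M\<close> leaves a conic bundle with three degenerate fibres, i.e. the plane blown up in four
  points.  The indices below stand for the contracted components, the four exceptional curves
  (which are sections of the conic bundle) and the class of a line; they form a permuted basis.\<close>

datatype coord = Fibre int | Section bool bool | Line

text \<open>Minus the intersection number of x with the fibre component l_k, or with l_0 - l_k if s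
  holds. A flip exchanges the two.\<close>

definition signed_coord :: "(int \<Rightarrow> int) \<Rightarrow> int \<Rightarrow> bool \<Rightarrow> int" where
  "signed_coord x k s = (if s then - x (-1) - x k else x k)"

context two_block_action
begin

text \<open>Conics through four points of the plane form a conic bundle whose three degenerate
  fibres are the pairs of lines joining the points. If the points are labelled by (Z/2)^2, a nonzero
  translation preserves each pair, swaps the lines in two of the pairs and in the third fixes both
  lines. This is the pattern of the signs e1, e2, e1 + e2 at a, b, M, so the group permutes the four
  points by translations.\<close>

lemma coboundary_of_fixed_points:
  assumes f: "cocycle (lat M) H f"
    and a: "a \<in> A1" and b: "b \<in> A2"
    and fixed: "\<And>\<sigma>. \<sigma> \<in> H \<Longrightarrow> perm \<sigma> a = a \<and> perm \<sigma> b = b"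
  shows "multiple_coboundary (lat M) H 1 f"
proof -
  let ?I = "{1..int M}"
  define V where "V = ?I - {a, b, int M}"
  let ?F = "\<lambda>\<sigma>. block_flip N1 N2 (e1 \<sigma>) (e2 \<sigma>)"
  let ?m = "\<lambda>\<sigma> \<rho>. \<sigma> \<otimes>\<^bsub>BijGroup (lat M)\<^esub> \<rho>"
  let ?inv = "\<lambda>\<sigma>. inv\<^bsub>BijGroup (lat M)\<^esub> \<sigma>"
  have abM: "a \<noteq> b" "a \<noteq> int M" "b \<noteq> int M" "a \<in> ?I" "b \<in> ?I" "int M \<in> ?I"
    using a b blocks_disjoint unfolding I_split by auto
  have V_sub: "V \<subseteq> ?I" and fin_V: "finite V" by (auto simp: V_def)
  have I_V: "?I = insert a (insert b (insert (int M) V))" using abM by (auto simp: V_def)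
  have sum_I: "(\<Sum>k\<in>?I. g k) = g a + g b + g (int M) + (\<Sum>k\<in>V. g k)" for g :: "int \<Rightarrow> int"
    unfolding I_V using abM fin_V by (simp add: V_def)
  have I_cases: "k = a \<or> k = b \<or> k = int M \<or> k \<in> V" if "k \<in> ?I" for k
    using that by (auto simp: V_def)
  have V_split: "V = (A1 - {a}) \<union> (A2 - {b})"
    using a b blocks_disjoint unfolding V_def I_split by auto

  have F_mult: "?F (?m \<sigma> \<rho>) k \<longleftrightarrow> ?F \<sigma> k \<noteq> ?F \<rho> (perm \<sigma> k)" if "\<sigma> \<in> H" "\<rho> \<in> H" "k \<in> V" for \<sigma> \<rho> k
    using that act_mult(2,3)[OF that(1,2)] perm_in[OF that(1)] blocks_disjoint
    unfolding V_split by (auto simp: block_flip_def)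
  have perm_V: "perm \<sigma> k \<in> V" if s: "\<sigma> \<in> H" and k: "k \<in> V" for \<sigma> k
  proof -
    have "perm \<sigma> k \<noteq> l" if "l \<in> {a, b, int M}" for l
    proof -
      have l: "l \<in> ?I" "perm \<sigma> l = l" "l \<noteq> k"
        using that abM fixed[OF s] act(4)[OF s] k by (auto simp: V_def)
      show ?thesis
        using inj_onD[OF bij_betw_imp_inj_on[OF perm_bij(3)[OF s]], of k l] l k V_sub by auto
    qed
    thus ?thesis using perm_in(3)[OF s, of k] k V_sub by (auto simp: V_def)
  qed
  have bij_V: "bij_betw (perm \<sigma>) V V" if s: "\<sigma> \<in> H" for \<sigma>
  proof -
    have "inj_on (perm \<sigma>) V"
      using bij_betw_imp_inj_on[OF perm_bij(3)[OF s]] V_sub by (rule inj_on_subset)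
    moreover have "perm \<sigma> ` V \<subseteq> V" using perm_V[OF s] by auto
    ultimately show ?thesis using fin_V by (simp add: bij_betw_def endo_inj_surj)
  qed
  have no_flip: "\<not> ?F \<sigma> v" if "\<sigma> \<in> H" "v \<in> V" "perm \<sigma> v = v" for \<sigma> v
  proof (cases "v \<in> A1")
    case True
    thus ?thesis using act(2)[OF that(1)] a fixed[OF that(1)] that
      by (auto simp: frobenius_on_def block_flip_def V_def)
  next
    case False
    hence "v \<in> A2" "v \<noteq> b" using that(2) unfolding V_split by auto
    thus ?thesis using act(3)[OF that(1)] b fixed[OF that(1)] that False
      by (auto simp: frobenius_on_def block_flip_def)
  qed
  \<comment> \<open>Hence one component of each fibre over an orbit in \<open>V\<close> can be chosen consistently;
    \<open>B\<close> is the set where it is \<open>l\<^sub>0 - l\<^sub>v\<close>.\<close>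
  have F_eq: "?F \<sigma> v = ?F \<rho> v" if s: "\<sigma> \<in> H" and r: "\<rho> \<in> H" and v: "v \<in> V" and eq: "perm \<sigma> v = perm \<rho> v" for \<sigma> \<rho> v
  proof -
    have i: "?inv \<rho> \<in> H" using r by (rule inv_closed)
    have one: "?m \<rho> (?inv \<rho>) = \<one>\<^bsub>BijGroup (lat M)\<^esub>"
      using group.r_inv[OF group_BijGroup in_carrier[OF r]] .
    have vI: "v \<in> ?I" using v V_sub by auto
    have "perm (?m \<sigma> (?inv \<rho>)) v = v"
      using act_mult(1)[OF s i vI] act_mult(1)[OF r i vI] act_one(1)[OF vI] eq one by simp
    hence "\<not> ?F (?m \<sigma> (?inv \<rho>)) v" using no_flip mult_closed[OF s i] v by blast
    moreover have "\<not> ?F (?m \<rho> (?inv \<rho>)) v" using one act_one(2,3) by (simp add: block_flip_def)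
    ultimately show ?thesis using F_mult[OF s i v] F_mult[OF r i v] eq by simp
  qed

  \<comment> \<open>The signs on V are trivialised orbit by orbit: \<open>rep v\<close> depends on
    the orbit only, and \<open>B v\<close> is the sign acquired on the way from v to
    \<open>rep v\<close>, by \<open>F_eq\<close> independent of the element used.\<close>
  define orb where "orb v = (\<lambda>\<sigma>. perm \<sigma> v) ` H" for v
  define rep where "rep v = (SOME r. r \<in> orb v)" for v
  define B where "B v \<longleftrightarrow> (\<exists>\<sigma>\<in>H. perm \<sigma> v = rep v \<and> ?F \<sigma> v)" for v
  have B_iff: "B v \<longleftrightarrow> ?F \<rho> v" if r: "\<rho> \<in> H" "v \<in> V" "perm \<rho> v = rep v" for \<rho> v
  proof
    assume "B v"
    then obtain \<sigma> where s: "\<sigma> \<in> H" "perm \<sigma> v = rep v" "?F \<sigma> v" unfolding B_def by blast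
    thus "?F \<rho> v" using F_eq[OF s(1) r(1,2)] r(3) by simp
  qed (use r in \<open>auto simp: B_def\<close>)
  have B_perm: "B (perm \<sigma> v) \<longleftrightarrow> B v \<noteq> ?F \<sigma> v" if s: "\<sigma> \<in> H" and v: "v \<in> V" for \<sigma> v
  proof -
    let ?w = "perm \<sigma> v"
    have vI: "v \<in> ?I" using v V_sub by auto
    have w: "?w \<in> V" by (rule perm_V[OF s v])
    have "orb ?w = orb v"
    proof (intro equalityI subsetI)
      fix y assume "y \<in> orb ?w"
      then obtain \<rho> where r: "\<rho> \<in> H" "y = perm \<rho> ?w" by (auto simp: orb_def)
      have "y = perm (?m \<sigma> \<rho>) v" using act_mult(1)[OF s r(1) vI] r(2) by simp
      thus "y \<in> orb v" using mult_closed[OF s r(1)] by (auto simp: orb_def)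
    next
      fix y assume "y \<in> orb v"
      then obtain \<rho> where r: "\<rho> \<in> H" "y = perm \<rho> v" by (auto simp: orb_def)
      have i: "?inv \<sigma> \<in> H" using s by (rule inv_closed)
      have "perm (?inv \<sigma>) ?w = v"
        using act_mult(1)[OF s i vI] group.r_inv[OF group_BijGroup in_carrier[OF s]] act_one(1)[OF vI] by simp
      hence "y = perm (?m (?inv \<sigma>) \<rho>) ?w" using act_mult(1)[OF i r(1)] w V_sub r(2) by auto
      thus "y \<in> orb ?w" using mult_closed[OF i r(1)] by (auto simp: orb_def)
    qed
    hence rep_eq: "rep ?w = rep v" by (simp add: rep_def)
    have "rep ?w \<in> orb ?w" unfolding rep_def some_in_eq orb_def using one_closed by blast
    then obtain \<rho> where r: "\<rho> \<in> H" "perm \<rho> ?w = rep ?w" by (auto simp: orb_def)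
    have "B ?w \<longleftrightarrow> ?F \<rho> ?w" by (rule B_iff[OF r(1) w r(2)])
    moreover have m: "?m \<sigma> \<rho> \<in> H" "perm (?m \<sigma> \<rho>) v = rep v"
      using mult_closed[OF s r(1)] act_mult(1)[OF s r(1) vI] r(2) rep_eq by auto
    hence "B v \<longleftrightarrow> ?F (?m \<sigma> \<rho>) v" by (intro B_iff[OF _ v])
    ultimately show ?thesis using F_mult[OF s r(1) v] by auto
  qed

  \<comment> \<open>\<open>T i j\<close> has odd size; this makes \<open>\<psi> i j\<close>, the intersection number with a section of
    self-intersection \<open>-1\<close>, integral.\<close>
  define p where "p = even (card {k \<in> V. B k})"
  define T where "T i j k = (if k = a then i \<noteq> p else if k = b then j else if k = int M then i \<noteq> j else B k)" for i j k
  have T_simps: "T i j a = (i \<noteq> p)" "T i j b = j" "T i j (int M) = (i \<noteq> j)" for i j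
    using abM by (auto simp: T_def)
  have T_V: "T i j k = B k" if "k \<in> V" for i j k using that by (auto simp: T_def V_def)
  have card_B: "int (card {k \<in> V. B k}) = (\<Sum>k\<in>V. if B k then 1 else 0)"
    using fin_V by (simp add: sum.If_cases Int_def)
  \<comment> \<open>Modulo 2 the indices a, b, M contribute (i + p) + j + (i + j) = p for all i and
    j, so a single p corrects the parity of B for all four sections.\<close>
  have odd_T: "odd (\<Sum>k\<in>?I. if T i j k then 1 else (0::int))" for i j
  proof -
    have "(\<Sum>k\<in>V. if T i j k then 1 else (0::int)) = int (card {k \<in> V. B k})"
      unfolding card_B by (rule sum.cong) (auto simp: T_V)
    thus ?thesis unfolding sum_I T_simps by (auto simp: p_def)
  qed
  \<comment> \<open>The coefficient of l_0 that gives l_{-1} + c l_0 minus the sum of the l_k with k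
    in T self-intersection 2 c - card T = -1. Then \<psi> i j x is the intersection number of x with
    this class.\<close>
  define c where "c i j = ((\<Sum>k\<in>?I. if T i j k then 1 else (0::int)) - 1) div 2" for i j
  define \<psi> where "\<psi> i j x = x 0 + c i j * x (-1) + (\<Sum>k\<in>?I. if T i j k then x k else 0)" for i j and x :: "int \<Rightarrow> int"
  \<comment> \<open>Let C be the sum of the contracted components, l_k or l_0 - l_k according to B,
    and E the sum of the four sections. With L the class of a line, -K = 3 L - E - C and l_0 = 2 L -
    E, hence L = -K - l_0 + C. Here \<open>W x\<close> is - x.C and \<open>lam x\<close> is
    x.L.\<close>
  define W where "W x = (\<Sum>k\<in>V. signed_coord x k (B k))" for x
  define lam where "lam x = deg M x + x (-1) - W x" for x
  have two_psi: "2 * \<psi> i j x = deg M x - x (-1) - (\<Sum>k\<in>?I. signed_coord x k (T i j k))" for i j x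
  proof -
    let ?n = "\<Sum>k\<in>?I. if T i j k then 1 else (0::int)"
    have "2 * c i j = ?n - 1" using odd_T[of i j] by (simp add: c_def)
    hence "2 * (c i j * x (-1)) = (?n - 1) * x (-1)" by (metis mult.assoc)
    moreover have "?n * x (-1) = (\<Sum>k\<in>?I. if T i j k then x (-1) else 0)"
      unfolding sum_distrib_right by (rule sum.cong) auto
    moreover have "(\<Sum>k\<in>?I. signed_coord x k (T i j k)) = (\<Sum>k\<in>?I. x k)
        - 2 * (\<Sum>k\<in>?I. if T i j k then x k else 0) - (\<Sum>k\<in>?I. if T i j k then x (-1) else 0)"
      unfolding sum_distrib_left sum_subtractf[symmetric] by (rule sum.cong) (auto simp: signed_coord_def)
    ultimately show ?thesis unfolding deg_def \<psi>_def by (simp add: algebra_simps)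
  qed
  have two_psi': "2 * \<psi> i j x = deg M x - x (-1) - signed_coord x a (i \<noteq> p) - signed_coord x b j
      - signed_coord x (int M) (i \<noteq> j) - W x" for i j x
  proof -
    have "(\<Sum>k\<in>V. signed_coord x k (T i j k)) = W x"
      unfolding W_def by (rule sum.cong) (auto simp: T_V)
    thus ?thesis unfolding two_psi sum_I T_simps by simp
  qed
  note psi4 = two_psi'[of False False] two_psi'[of False True] two_psi'[of True False] two_psi'[of True True]
  \<comment> \<open>The inverse change of basis. The first equation is l_0 = 2 L - E; in the next
    three a component over a, b or M is the line through two of the four points, L minus two
    sections; the last one restates \<open>lam\<close>.\<close>
  have solve: "x (-1) = 2 * lam x - (\<psi> False False x + \<psi> False True x + \<psi> True False x + \<psi> True True x)"
    "signed_coord x a p = \<psi> True False x + \<psi> True True x - lam x"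
    "x b = \<psi> False True x + \<psi> True True x - lam x"
    "x (int M) = \<psi> True False x + \<psi> False True x - lam x"
    "deg M x = lam x - x (-1) + W x" for x
    using psi4[of x] unfolding lam_def signed_coord_def by (cases p; simp; linarith)+

  have coord_act: "signed_coord (\<sigma> x) k s = signed_coord x (perm \<sigma> k) (s \<noteq> ?F \<sigma> k)"
    if "\<sigma> \<in> H" "x \<in> lat M" "k \<in> ?I" for \<sigma> x k s
    using sgn_actD(2,4)[OF act(1)[OF that(1)] that(2)] that(3) by (simp add: signed_coord_def)
  have W_act: "W (\<sigma> x) = W x" if s: "\<sigma> \<in> H" and x: "x \<in> lat M" for \<sigma> x
  proof -
    have "W (\<sigma> x) = (\<Sum>k\<in>V. signed_coord x (perm \<sigma> k) (B (perm \<sigma> k)))"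
      unfolding W_def using coord_act[OF s x] B_perm[OF s] V_sub by (intro sum.cong) auto
    also have "\<dots> = W x" unfolding W_def by (rule sum.reindex_bij_betw[OF bij_V[OF s]])
    finally show ?thesis .
  qed
  \<comment> \<open>Flipping the first block changes membership in T at a and M, flipping the second
    at b and M; on V the change of sign is absorbed by \<open>B_perm\<close>.\<close>
  have psi_act: "\<psi> i j (\<sigma> x) = \<psi> (i \<noteq> e1 \<sigma>) (j \<noteq> e2 \<sigma>) x" if s: "\<sigma> \<in> H" and x: "x \<in> lat M" for \<sigma> x i j
  proof -
    have T_act: "T (i \<noteq> e1 \<sigma>) (j \<noteq> e2 \<sigma>) (perm \<sigma> k) \<longleftrightarrow> T i j k \<noteq> ?F \<sigma> k" if k: "k \<in> ?I" for k
    proof -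
      consider "k = a" | "k = b" | "k = int M" | "k \<in> V" using I_cases[OF k] by blast
      thus ?thesis
      proof cases
        case 4
        thus ?thesis using T_V B_perm[OF s] perm_V[OF s] by simp
      qed (use fixed[OF s] act(4)[OF s] T_simps a b blocks_disjoint in \<open>auto simp: block_flip_def\<close>)
    qed
    have "(\<Sum>k\<in>?I. signed_coord (\<sigma> x) k (T i j k))
        = (\<Sum>k\<in>?I. signed_coord x (perm \<sigma> k) (T (i \<noteq> e1 \<sigma>) (j \<noteq> e2 \<sigma>) (perm \<sigma> k)))"
      using coord_act[OF s x] T_act by (intro sum.cong) auto
    also have "\<dots> = (\<Sum>k\<in>?I. signed_coord x k (T (i \<noteq> e1 \<sigma>) (j \<noteq> e2 \<sigma>) k))"
      by (rule sum.reindex_bij_betw[OF perm_bij(3)[OF s]])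
    finally have "2 * \<psi> i j (\<sigma> x) = 2 * \<psi> (i \<noteq> e1 \<sigma>) (j \<noteq> e2 \<sigma>) x"
      unfolding two_psi using sgn_actD(2,3)[OF act(1)[OF s] x] by simp
    thus ?thesis by simp
  qed

  define \<phi> where "\<phi> t x = (case t of Fibre k \<Rightarrow> signed_coord x k (B k) | Section i j \<Rightarrow> \<psi> i j x | Line \<Rightarrow> lam x)" for t x
  have W_plus: "W (\<lambda>k. x k + y k) = W x + W y" for x y
    unfolding W_def sum.distrib[symmetric] by (rule sum.cong) (auto simp: signed_coord_def)
  have psi_plus: "\<psi> i j (\<lambda>k. x k + y k) = \<psi> i j x + \<psi> i j y" for i j x y
  proof -
    have "(\<Sum>k\<in>?I. if T i j k then x k + y k else 0) =
      (\<Sum>k\<in>?I. if T i j k then x k else 0) + (\<Sum>k\<in>?I. if T i j k then y k else 0)"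
      unfolding sum.distrib[symmetric] by (rule sum.cong) auto
    thus ?thesis by (simp add: \<psi>_def algebra_simps)
  qed
  show ?thesis
  proof (rule permutation_coboundary[OF f, where X = "Fibre ` V \<union> range (case_prod Section) \<union> {Line}" and \<phi> = \<phi>])
    fix t x y
    show "\<phi> t (\<lambda>k. x k + y k) = \<phi> t x + \<phi> t y"
      by (cases t) (simp_all add: \<phi>_def psi_plus lam_def W_plus deg_plus signed_coord_def)
  next
    fix \<sigma> t assume s: "\<sigma> \<in> H" and t: "t \<in> Fibre ` V \<union> range (case_prod Section) \<union> {Line}"
    consider k where "k \<in> V" "t = Fibre k" | i j where "t = Section i j" | "t = Line" using t by auto
    thus "\<exists>u\<in>Fibre ` V \<union> range (case_prod Section) \<union> {Line}. \<forall>x\<in>lat M. \<phi> t (\<sigma> x) = \<phi> u x"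
    proof cases
      case 1
      thus ?thesis using coord_act[OF s] B_perm[OF s 1(1)] V_sub perm_V[OF s 1(1)]
        by (intro bexI[where x = "Fibre (perm \<sigma> k)"]) (auto simp: \<phi>_def)
    next
      case 2
      thus ?thesis using psi_act[OF s]
        by (intro bexI[where x = "Section (i \<noteq> e1 \<sigma>) (j \<noteq> e2 \<sigma>)"]) (auto simp: \<phi>_def)
    next
      case 3
      thus ?thesis using W_act[OF s] sgn_actD(2,3)[OF act(1)[OF s]]
        by (intro bexI[where x = Line]) (auto simp: \<phi>_def lam_def)
    qed
  next
    fix x y assume x: "x \<in> lat M" and y: "y \<in> lat M"
      and eq: "\<And>t. t \<in> Fibre ` V \<union> range (case_prod Section) \<union> {Line} \<Longrightarrow> \<phi> t x = \<phi> t y"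
    have lam: "lam x = lam y" using eq[of Line] by (simp add: \<phi>_def)
    have psi: "\<psi> i j x = \<psi> i j y" for i j using eq[of "Section i j"] by (force simp: \<phi>_def)
    have coord: "signed_coord x k (B k) = signed_coord y k (B k)" if "k \<in> V" for k
      using eq[of "Fibre k"] that by (simp add: \<phi>_def)
    have W: "W x = W y" unfolding W_def using coord by (rule sum.cong[OF refl])
    have m: "x (-1) = y (-1)" using solve(1)[of x] solve(1)[of y] lam psi by simp
    show "x = y"
    proof (rule lat_eqI[OF x y m])
      show "deg M x = deg M y" using solve(5)[of x] solve(5)[of y] lam W m by simp
      fix k assume "k \<in> ?I"
      then consider "k = a" | "k = b" | "k = int M" | "k \<in> V" using I_cases by blast
      thus "x k = y k"
      proof cases
        case 1
        thus ?thesis using solve(2)[of x] solve(2)[of y] lam psi m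
          by (simp add: signed_coord_def split: if_splits)
      next
        case 4
        thus ?thesis using coord[OF 4] m by (simp add: signed_coord_def split: if_splits)
      qed (use solve(3,4)[of x] solve(3,4)[of y] lam psi in simp_all)
    qed
  next
    fix q :: "coord \<Rightarrow> int"
    let ?s = "\<lambda>i j. q (Section i j)" and ?r = "q Line"
    \<comment> \<open>The values of x_{-1} and of the coordinates at a, b, M are forced by
      \<open>solve\<close>; p decides which component \<alpha> refers to.\<close>
    define m where "m = 2 * ?r - (?s False False + ?s False True + ?s True False + ?s True True)"
    define \<alpha> \<beta> \<gamma> where "\<alpha> = ?s True False + ?s True True - ?r"
      and "\<beta> = ?s False True + ?s True True - ?r" and "\<gamma> = ?s True False + ?s False True - ?r"
    define z where "z k = (if k = a then (if p then - m - \<alpha> else \<alpha>) else if k = b then \<beta>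
      else if k = int M then \<gamma> else if B k then - m - q (Fibre k) else q (Fibre k))" for k
    define D where "D = ?r - m + (\<Sum>k\<in>V. q (Fibre k))"
    define x where "x k = (if k = -1 then m else if k = 0 then (D - (\<Sum>k\<in>?I. z k)) div 2
      else if k \<in> ?I then z k else 0)" for k
    have x_I: "x k = z k" if "k \<in> ?I" for k using that by (auto simp: x_def)
    have z_simps: "z a = (if p then - m - \<alpha> else \<alpha>)" "z b = \<beta>" "z (int M) = \<gamma>"
      using abM by (auto simp: z_def)
    \<comment> \<open>x_0 is half of this number. Modulo 2, \<alpha> + \<beta> + \<gamma> equals
      \<open>?r\<close>, and what remains is m times (p + card B - 1), with p read as 0 or 1 and
      card B the number of k in V with \<open>B k\<close>; the second factor is even by the choice
      of p.\<close>
    have "even (D - (\<Sum>k\<in>?I. z k))"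
    proof -
      have "(\<Sum>k\<in>V. z k) = (\<Sum>k\<in>V. q (Fibre k)) - m * (\<Sum>k\<in>V. if B k then 1 else 0)
          - 2 * (\<Sum>k\<in>V. if B k then q (Fibre k) else 0)"
        unfolding sum_distrib_left sum_subtractf[symmetric] by (rule sum.cong) (auto simp: z_def V_def)
      thus ?thesis unfolding sum_I z_simps D_def card_B[symmetric]
        by (auto simp: \<alpha>_def \<beta>_def \<gamma>_def p_def)
    qed
    moreover have "(\<Sum>k\<in>?I. x k) = (\<Sum>k\<in>?I. z k)" using x_I by (rule sum.cong[OF refl])
    ultimately have deg: "deg M x = D" by (simp add: deg_def x_def)
    have xm: "x (-1) = m" by (simp add: x_def)
    have coord_V: "signed_coord x k (B k) = q (Fibre k)" if "k \<in> V" for k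
      using that x_I[of k] V_sub xm by (auto simp: signed_coord_def z_def V_def)
    hence W: "W x = (\<Sum>k\<in>V. q (Fibre k))" unfolding W_def by (intro sum.cong) auto
    have lam: "lam x = ?r" unfolding lam_def deg W xm D_def by simp
    have coord: "signed_coord x a (i \<noteq> p) = (if i then - m - \<alpha> else \<alpha>)"
      "signed_coord x b i = (if i then - m - \<beta> else \<beta>)"
      "signed_coord x (int M) i = (if i then - m - \<gamma> else \<gamma>)" for i
      using x_I[OF abM(4)] x_I[OF abM(5)] x_I[OF abM(6)] xm z_simps by (auto simp: signed_coord_def)
    have psi: "\<psi> i j x = ?s i j" for i j
    proof -
      have "2 * \<psi> i j x = 2 * ?s i j"
        unfolding two_psi' deg W xm coord D_def \<alpha>_def \<beta>_def \<gamma>_def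
        by (cases i; cases j) (simp_all add: m_def)
      thus ?thesis by simp
    qed
    have "x \<in> lat M" by (auto simp: lat_def x_def)
    moreover have "\<phi> t x = q t" if "t \<in> Fibre ` V \<union> range (case_prod Section) \<union> {Line}" for t
      using that coord_V lam psi by (auto simp: \<phi>_def)
    ultimately show "\<exists>x\<in>lat M. \<forall>t\<in>Fibre ` V \<union> range (case_prod Section) \<union> {Line}. \<phi> t x = q t" by blast
  qed
qed

theorem H1_vanish_two_block: "H1_vanish (lat M) H"
  unfolding H1_vanish_iff
proof (intro allI impI)
  fix f assume f: "cocycle (lat M) H f"
  have A1: "finite A1" "odd (card A1)" "A1 \<subseteq> {1..int M}"
    and A2: "finite A2" "odd (card A2)" "A2 \<subseteq> {1..int M}"
    using odd_N1 odd_N2 by (auto simp: block1_def block2_def M_def)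
  obtain a L m where L: "a \<in> A1" "L = {\<sigma> \<in> H. perm \<sigma> a = a}" "subgroup L (BijGroup (lat M))" "odd m"
    "\<And>n. multiple_coboundary (lat M) L n f \<Longrightarrow> multiple_coboundary (lat M) H (m * n) f"
    by (rule stabilizer_transfer[OF f A1 perm_bij(1)]) blast+
  have LH: "L \<subseteq> H" using L(2) by auto
  interpret L: two_block_action N1 N2 M L by (rule two_block_subgroup[OF L(3) LH])
  have fL: "cocycle (lat M) L f" by (rule cocycle_subset[OF f LH])
  obtain b L' m' where L': "b \<in> A2" "L' = {\<sigma> \<in> L. perm \<sigma> b = b}" "subgroup L' (BijGroup (lat M))" "odd m'"
    "\<And>n. multiple_coboundary (lat M) L' n f \<Longrightarrow> multiple_coboundary (lat M) L (m' * n) f"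
    by (rule L.stabilizer_transfer[OF fL A2 L.perm_bij(2)]) blast+
  have LL: "L' \<subseteq> L" using L'(2) by auto
  interpret L': two_block_action N1 N2 M L' by (rule L.two_block_subgroup[OF L'(3) LL])
  have "multiple_coboundary (lat M) L' 1 f"
    using L(2) L'(2) by (intro L'.coboundary_of_fixed_points[OF cocycle_subset[OF fL LL] L(1) L'(1)]) auto
  hence "multiple_coboundary (lat M) H (m * (m' * 1)) f" by (intro L(5) L'(5))
  moreover obtain c where c: "c \<in> {1, 2, 4}" "multiple_coboundary (lat M) H c f"
    using coboundary_power_of_2[OF f] by blast
  moreover have "coprime (2 ^ i) (m * (m' * 1))" for i using L(4) L'(4) by simp
  from this[of 0] this[of 1] this[of 2] have "coprime c (m * (m' * 1))" using c(1) by auto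
  ultimately show "multiple_coboundary (lat M) H 1 f" using coprime_coboundary by blast
qed

end

section \<open>Groups generated by two blocks\<close>

text \<open>\<open>Q \<tau> e\<close> describes the pairs of a permutation and a block sign that may
  occur; closed under composition, it passes from the generators s (flipping) and t to the group. In
  \<open>invariant\<close>, m stands for -x_{-1}, and the conclusion is the form that the
  coordinates of a fixed vector take on the block.\<close>

locale flip_block =
  fixes A :: "int set" and Q :: "(int \<Rightarrow> int) \<Rightarrow> bool \<Rightarrow> bool" and s t :: "int \<Rightarrow> int"
  assumes Q_id: "Q id False"
    and Q_comp: "\<And>\<tau> e \<tau>' e'. Q \<tau> e \<Longrightarrow> Q \<tau>' e' \<Longrightarrow> Q (\<lambda>k. \<tau>' (\<tau> k)) (e \<noteq> e')"
    and Q_cong: "\<And>\<tau> \<tau>' e. Q \<tau> e \<Longrightarrow> (\<And>k. k \<in> A \<Longrightarrow> \<tau> k = \<tau>' k) \<Longrightarrow> Q \<tau>' e"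
    and Q_frobenius: "\<And>\<tau> e. Q \<tau> e \<Longrightarrow> frobenius_on A \<tau> e"
    and Q_s: "Q s True" and Q_t: "Q t False"
    and s_outside: "\<And>k. k \<notin> A \<Longrightarrow> s k = k" and t_outside: "\<And>k. k \<notin> A \<Longrightarrow> t k = k"
    and invariant: "\<And>x m k. (\<And>k. k \<in> A \<Longrightarrow> x k = m - x (s k)) \<Longrightarrow> (\<And>k. k \<in> A \<Longrightarrow> x k = x (t k)) \<Longrightarrow>
          k \<in> A \<Longrightarrow> 2 * x k = (m :: int)"

lemma two_block_bij:
  assumes "M = N1 + N2 + 1" "bij_betw \<tau> (block1 N1) (block1 N1)"
    "bij_betw \<tau> (block2 N1 N2) (block2 N1 N2)" "\<tau> (int M) = int M"
  shows "bij_betw \<tau> {1..int M} {1..int M}"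
proof -
  have I: "{1..int M} = {int M} \<union> (block1 N1 \<union> block2 N1 N2)"
    using assms(1) by (auto simp: block1_def block2_def)
  show ?thesis unfolding I using assms
    by (intro bij_betw_combine) (auto simp: block1_def block2_def)
qed

lemma card_block_flip:
  assumes "M = N1 + N2 + 1" "odd N1" "odd N2"
  shows "even (card {k \<in> {1..int M}. block_flip N1 N2 e1 e2 k})"
proof -
  have "{k \<in> {1..int M}. block_flip N1 N2 e1 e2 k} = (if e1 then block1 N1 else {}) \<union>
      ((if e2 then block2 N1 N2 else {}) \<union> (if e1 \<noteq> e2 then {int M} else {}))"
    using assms(1) by (auto simp: block_flip_def block1_def block2_def)
  moreover have "card \<dots> = card (if e1 then block1 N1 else {}) +
      (card (if e2 then block2 N1 N2 else {}) + card (if e1 \<noteq> e2 then {int M} else {}))"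
    using assms(1) by (subst card_Un_disjoint; (subst card_Un_disjoint)?) (auto simp: block1_def block2_def)
  ultimately show ?thesis using assms by (auto simp: block1_def block2_def)
qed

text \<open>Left multiplication by a is injective on the finite set S, hence onto, so S contains a
  right inverse of a.\<close>

lemma finite_submonoid_subgroup:
  assumes "group G" "finite S" "S \<subseteq> carrier G" "\<one>\<^bsub>G\<^esub> \<in> S"
    and mult: "\<And>x y. x \<in> S \<Longrightarrow> y \<in> S \<Longrightarrow> x \<otimes>\<^bsub>G\<^esub> y \<in> S"
  shows "subgroup S G"
proof -
  interpret group G by fact
  show ?thesis
  proof (rule subgroupI)
    fix a assume a: "a \<in> S"
    have "inj_on (\<lambda>y. a \<otimes>\<^bsub>G\<^esub> y) S" using inj_on_cmult[of a] a assms(3) by (meson inj_on_subset subsetD)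
    hence "(\<lambda>y. a \<otimes>\<^bsub>G\<^esub> y) ` S = S" using assms(2) mult[OF a] by (intro endo_inj_surj) auto
    then obtain y where y: "y \<in> S" "a \<otimes>\<^bsub>G\<^esub> y = \<one>\<^bsub>G\<^esub>" using assms(4) by (metis imageE)
    have "inv\<^bsub>G\<^esub> a = y" using y a assms(3) by (metis inv_equality inv_comm subsetD)
    thus "inv\<^bsub>G\<^esub> a \<in> S" using y by simp
  qed (use assms in auto)
qed

text \<open>The maps of the required shape form a finite submonoid S of \<open>BijGroup\<close>,
  hence a subgroup. As S contains the generators, every element of the generated group has this
  shape.\<close>

lemma two_block_action_generated:
  assumes M: "M = N1 + N2 + 1" and odd: "odd N1" "odd N2"
    and Q1: "flip_block (block1 N1) Q1 s1 t1" and Q2: "flip_block (block2 N1 N2) Q2 s2 t2"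
    and gens: "\<And>g. g \<in> gens \<Longrightarrow> \<exists>e1 e2. fst g = {k \<in> {1..int M}. block_flip N1 N2 e1 e2 k} \<and>
           Q1 (snd g) e1 \<and> Q2 (snd g) e2 \<and> snd g (int M) = int M"
  shows "two_block_action N1 N2 M (gen_grp M gens)"
    and "\<And>g. g \<in> gens \<Longrightarrow> restrict (Phi M g) (lat M) \<in> gen_grp M gens"
    and "\<And>g. g \<in> gens \<Longrightarrow> sgn_act M (restrict (Phi M g) (lat M)) (\<lambda>k. k \<in> fst g) (snd g)"
proof -
  interpret G: group "BijGroup (lat M)" by (rule group_BijGroup)
  interpret Q1: flip_block "block1 N1" Q1 s1 t1 by fact
  interpret Q2: flip_block "block2 N1 N2" Q2 s2 t2 by fact
  let ?I = "{1..int M}"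
  define good where "good \<sigma> \<tau> e1 e2 \<longleftrightarrow> sgn_act M \<sigma> (block_flip N1 N2 e1 e2) \<tau> \<and> Q1 \<tau> e1 \<and> Q2 \<tau> e2 \<and> \<tau> (int M) = int M"
    for \<sigma> \<tau> e1 e2
  define S where "S = {\<sigma> \<in> carrier (BijGroup (lat M)). \<exists>\<tau> e1 e2. good \<sigma> \<tau> e1 e2}"
  have blocks: "bij_betw \<tau> (block1 N1) (block1 N1)" "bij_betw \<tau> (block2 N1 N2) (block2 N1 N2)"
    if "Q1 \<tau> e1" "Q2 \<tau> e2" for \<tau> e1 e2
    using Q1.Q_frobenius[OF that(1)] Q2.Q_frobenius[OF that(2)] by (auto simp: frobenius_on_def)
  have bij: "bij_betw \<tau> ?I ?I" if "good \<sigma> \<tau> e1 e2" for \<sigma> \<tau> e1 e2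
    using that blocks M by (intro two_block_bij) (auto simp: good_def)
  have flip_perm: "block_flip N1 N2 e1 e2 (\<tau> k) = block_flip N1 N2 e1 e2 k"
    if "k \<in> ?I" "good \<sigma> \<tau> e1' e2'" for \<sigma> \<tau> e1 e2 e1' e2' k
  proof -
    have Q: "Q1 \<tau> e1'" "Q2 \<tau> e2'" using that(2) by (auto simp: good_def)
    have b: "\<tau> j \<in> block1 N1" if "j \<in> block1 N1" for j
      using bij_betw_imp_surj_on[OF blocks(1)[OF Q]] that by blast
    have b': "\<tau> j \<in> block2 N1 N2" if "j \<in> block2 N1 N2" for j
      using bij_betw_imp_surj_on[OF blocks(2)[OF Q]] that by blast
    have "block1 N1 \<inter> block2 N1 N2 = {}" by (auto simp: block1_def block2_def)
    moreover have "k \<in> block1 N1 \<or> k \<in> block2 N1 N2 \<or> k = int M"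
      using that(1) M by (auto simp: block1_def block2_def)
    ultimately show ?thesis using b[of k] b'[of k] that(2) by (auto simp: good_def block_flip_def)
  qed
  have mult: "\<sigma> \<otimes>\<^bsub>BijGroup (lat M)\<^esub> \<rho> \<in> S" if sr: "\<sigma> \<in> S" "\<rho> \<in> S" for \<sigma> \<rho>
  proof -
    obtain \<tau> e1 e2 \<tau>' e1' e2' where g: "good \<sigma> \<tau> e1 e2" "good \<rho> \<tau>' e1' e2'"
      using sr by (auto simp: S_def)
    have eq: "\<sigma> \<otimes>\<^bsub>BijGroup (lat M)\<^esub> \<rho> = compose (lat M) \<sigma> \<rho>"
      using sr by (simp add: S_def BijGroup_def)
    have "sgn_act M (compose (lat M) \<sigma> \<rho>) (\<lambda>k. block_flip N1 N2 e1 e2 k \<noteq> block_flip N1 N2 e1' e2' (\<tau> k)) (\<lambda>k. \<tau>' (\<tau> k))"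
      using g bij[OF g(1)] unfolding good_def by (intro sgn_act_compose) (auto simp: bij_betw_def)
    hence "sgn_act M (compose (lat M) \<sigma> \<rho>) (block_flip N1 N2 (e1 \<noteq> e1') (e2 \<noteq> e2')) (\<lambda>k. \<tau>' (\<tau> k))"
    proof (rule sgn_act_cong)
      fix k assume "k \<in> ?I"
      thus "(block_flip N1 N2 e1 e2 k \<noteq> block_flip N1 N2 e1' e2' (\<tau> k)) = block_flip N1 N2 (e1 \<noteq> e1') (e2 \<noteq> e2') k
          \<and> \<tau>' (\<tau> k) = \<tau>' (\<tau> k)"
        using flip_perm[OF _ g(1)] by (auto simp: block_flip_def)
    qed
    hence "good (compose (lat M) \<sigma> \<rho>) (\<lambda>k. \<tau>' (\<tau> k)) (e1 \<noteq> e1') (e2 \<noteq> e2')"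
      using g Q1.Q_comp Q2.Q_comp by (auto simp: good_def)
    moreover have "compose (lat M) \<sigma> \<rho> \<in> carrier (BijGroup (lat M))"
      using sr G.m_closed unfolding eq[symmetric] S_def by blast
    ultimately show ?thesis unfolding eq S_def by blast
  qed
  \<comment> \<open>An element of S is determined by its signs and its permutation on the indices,
    for which there are finitely many possibilities.\<close>
  have "finite S"
  proof (rule finite_imageD)
    let ?h = "\<lambda>\<sigma>. (restrict (flip_of \<sigma>) ?I, restrict (perm_of M \<sigma>) ?I)"
    have p: "flip_of \<sigma> k = block_flip N1 N2 e1 e2 k" "perm_of M \<sigma> k = \<tau> k" "\<tau> k \<in> ?I"
      if "good \<sigma> \<tau> e1 e2" "k \<in> ?I" for \<sigma> \<tau> e1 e2 k
    proof -
      show t: "\<tau> k \<in> ?I" using bij_betw_imp_surj_on[OF bij[OF that(1)]] that(2) by blast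
      show "flip_of \<sigma> k = block_flip N1 N2 e1 e2 k" "perm_of M \<sigma> k = \<tau> k"
        using that(1) sgn_act_unique[of M \<sigma> _ \<tau>, OF _ that(2) t] unfolding good_def by blast+
    qed
    have "?h ` S \<subseteq> (?I \<rightarrow>\<^sub>E UNIV) \<times> (?I \<rightarrow>\<^sub>E ?I)"
    proof (rule image_subsetI)
      fix \<sigma> assume "\<sigma> \<in> S"
      then obtain \<tau> e1 e2 where "good \<sigma> \<tau> e1 e2" by (auto simp: S_def)
      thus "(restrict (flip_of \<sigma>) ?I, restrict (perm_of M \<sigma>) ?I) \<in> (?I \<rightarrow>\<^sub>E UNIV) \<times> (?I \<rightarrow>\<^sub>E ?I)"
        using p(2,3) by auto
    qed
    moreover have "finite ((?I \<rightarrow>\<^sub>E (UNIV :: bool set)) \<times> (?I \<rightarrow>\<^sub>E ?I))"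
      by (intro finite_cartesian_product finite_PiE) auto
    ultimately show "finite (?h ` S)" by (rule finite_subset)
    show "inj_on ?h S"
    proof (rule inj_onI)
      fix \<sigma> \<rho> assume s: "\<sigma> \<in> S" and r: "\<rho> \<in> S" and eq: "?h \<sigma> = ?h \<rho>"
      obtain \<tau> e1 e2 \<tau>' e1' e2' where g: "good \<sigma> \<tau> e1 e2" "good \<rho> \<tau>' e1' e2'"
        using s r by (auto simp: S_def)
      have e: "block_flip N1 N2 e1 e2 k = block_flip N1 N2 e1' e2' k" "\<tau> k = \<tau>' k" if "k \<in> ?I" for k
        using fun_cong[of _ _ k] eq that p(1,2)[OF g(1) that] p(1,2)[OF g(2) that]
        by (metis (no_types, lifting) Pair_inject restrict_apply')+
      have "\<sigma> x = \<rho> x" if x: "x \<in> lat M" for x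
      proof (rule lat_eqI)
        note a = g(1)[unfolded good_def, THEN conjunct1] and b = g(2)[unfolded good_def, THEN conjunct1]
        show "\<sigma> x \<in> lat M" "\<rho> x \<in> lat M" "\<sigma> x (-1) = \<rho> x (-1)" "deg M (\<sigma> x) = deg M (\<rho> x)"
          using sgn_actD(1-3)[OF a x] sgn_actD(1-3)[OF b x] by auto
        show "\<sigma> x k = \<rho> x k" if "k \<in> ?I" for k
          using sgn_actD(4)[OF a x that] sgn_actD(4)[OF b x that] e[OF that] by simp
      qed
      moreover have "\<sigma> \<in> extensional (lat M)" "\<rho> \<in> extensional (lat M)"
        using s r by (auto simp: S_def BijGroup_def Bij_def)
      ultimately show "\<sigma> = \<rho>" by (metis extensionalityI)
    qed
  qed
  moreover have "\<one>\<^bsub>BijGroup (lat M)\<^esub> \<in> S"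
  proof -
    have "good \<one>\<^bsub>BijGroup (lat M)\<^esub> id False False"
      using Q1.Q_id Q2.Q_id by (simp add: good_def BijGroup_def sgn_act_def block_flip_def)
    thus ?thesis unfolding S_def by blast
  qed
  ultimately have S: "subgroup S (BijGroup (lat M))"
    using mult by (intro finite_submonoid_subgroup group_BijGroup) (auto simp: S_def)
  have gen: "sgn_act M (restrict (Phi M g) (lat M)) (\<lambda>k. k \<in> fst g) (snd g) \<and> restrict (Phi M g) (lat M) \<in> S"
    if g: "g \<in> gens" for g
  proof -
    obtain J \<tau> where gJ: "g = (J, \<tau>)" by (cases g)
    obtain e1 e2 where e: "J = {k \<in> ?I. block_flip N1 N2 e1 e2 k}" "Q1 \<tau> e1" "Q2 \<tau> e2" "\<tau> (int M) = int M"
      using gens[OF g] gJ by auto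
    have J: "J \<subseteq> ?I" "even (card J)" using e(1) card_block_flip[OF M odd, of e1 e2] by auto
    have b: "bij_betw \<tau> ?I ?I" using M blocks[OF e(2,3)] e(4) by (rule two_block_bij)
    note a = Phi_sgn_act[OF J b]
    have "sgn_act M (restrict (Phi M (J, \<tau>)) (lat M)) (block_flip N1 N2 e1 e2) \<tau>"
      by (rule sgn_act_cong[OF a]) (simp add: e(1))
    hence "good (restrict (Phi M (J, \<tau>)) (lat M)) \<tau> e1 e2" using e by (simp add: good_def)
    thus ?thesis using a Phi_in_BijGroup[OF J b] unfolding gJ S_def by auto
  qed
  let ?gens = "(\<lambda>g. restrict (Phi M g) (lat M)) ` gens"
  have gS: "?gens \<subseteq> S" using gen by blast
  have gc: "?gens \<subseteq> carrier (BijGroup (lat M))" using gS by (auto simp: S_def)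
  have sub: "gen_grp M gens \<subseteq> S"
    unfolding gen_grp_def by (rule G.generate_subgroup_incl[OF gS S])
  show "two_block_action N1 N2 M (gen_grp M gens)"
  proof (rule two_block_action.intro[OF M odd])
    show "subgroup (gen_grp M gens) (BijGroup (lat M))"
      unfolding gen_grp_def by (rule G.generate_is_subgroup[OF gc])
    show "finite (gen_grp M gens)" using sub \<open>finite S\<close> by (rule finite_subset)
    fix \<sigma> assume "\<sigma> \<in> gen_grp M gens"
    then obtain \<tau> e1 e2 where "good \<sigma> \<tau> e1 e2" using sub by (auto simp: S_def)
    thus "\<exists>\<tau> e1 e2. sgn_act M \<sigma> (block_flip N1 N2 e1 e2) \<tau> \<and> frobenius_on (block1 N1) \<tau> e1 \<and>
        frobenius_on (block2 N1 N2) \<tau> e2 \<and> \<tau> (int M) = int M"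
      using Q1.Q_frobenius Q2.Q_frobenius unfolding good_def by blast
  qed
  show "restrict (Phi M g) (lat M) \<in> gen_grp M gens" if "g \<in> gens" for g
    unfolding gen_grp_def using that by (intro generate.incl) auto
  show "sgn_act M (restrict (Phi M g) (lat M)) (\<lambda>k. k \<in> fst g) (snd g)" if "g \<in> gens" for g
    using gen[OF that] by blast
qed

section \<open>Invariant vectors and relative minimality\<close>

text \<open>The hypothesis makes all x_k equal to some b with x_{-1} = -2 b, which are the
  coordinates of b K outside l_0; and l_0 is itself invariant.\<close>

lemma (in two_block_action) rel_minI:
  assumes "\<And>x k. x \<in> lat M \<Longrightarrow> (\<And>\<sigma>. \<sigma> \<in> H \<Longrightarrow> \<sigma> x = x) \<Longrightarrow> k \<in> {1..int M} \<Longrightarrow> 2 * x k = - x (-1)"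
  shows "rel_min M H"
  unfolding rel_min_def
proof (intro equalityI subsetI)
  have K: "Kcan M k = (if k = -1 \<or> k = 0 then -2 else if k \<in> {1..int M} then 1 else 0)" for k
    by (auto simp: Kcan_def lb_def)
  fix x assume "x \<in> {x \<in> lat M. \<forall>\<sigma>\<in>H. \<sigma> x = x}"
  hence x: "x \<in> lat M" "\<And>\<sigma>. \<sigma> \<in> H \<Longrightarrow> \<sigma> x = x" by auto
  have k: "2 * x k = - x (-1)" if "k \<in> {1..int M}" for k
    by (rule assms[OF x(1) _ that]) (rule x(2))
  have 1: "2 * x 1 = - x (-1)" using M_def by (intro k) auto
  \<comment> \<open>K has l_0-coefficient -2, so x_1 K falls short of x by x_0 + 2 x_1 in this
    coordinate.\<close>
  have "x = (\<lambda>k. (x 0 + 2 * x 1) * lb 0 k + x 1 * Kcan M k)"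
  proof
    fix j
    consider "j < -1 \<or> j > int M" | "j = -1" | "j = 0" | "j \<in> {1..int M}" by fastforce
    thus "x j = (x 0 + 2 * x 1) * lb 0 j + x 1 * Kcan M j"
    proof cases
      case 1
      thus ?thesis using x(1) by (auto simp: lat_def lb_def K)
    next
      case 4
      thus ?thesis using k[OF 4] 1 by (simp add: K lb_def)
    qed (use 1 in \<open>simp_all add: K lb_def\<close>)
  qed
  thus "x \<in> {(\<lambda>k. a * lb 0 k + b * Kcan M k) |a b. True}" by blast
next
  have K: "Kcan M k = (if k = -1 \<or> k = 0 then -2 else if k \<in> {1..int M} then 1 else 0)" for k
    by (auto simp: Kcan_def lb_def)
  fix x assume "x \<in> {(\<lambda>k. a * lb 0 k + b * Kcan M k) |a b. True}"
  then obtain a b where ab: "x = (\<lambda>k. a * lb 0 k + b * Kcan M k)" by blast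
  have x: "x \<in> lat M" by (auto simp: lat_def ab K lb_def)
  have xk: "x k = b" if "k \<in> {1..int M}" for k using that by (simp add: ab K lb_def)
  have xm: "x (-1) = - 2 * b" by (simp add: ab K lb_def)
  have "\<sigma> x = x" if s: "\<sigma> \<in> H" for \<sigma>
  proof (rule lat_eqI)
    note a = act(1)[OF s]
    show "\<sigma> x \<in> lat M" "x \<in> lat M" "\<sigma> x (-1) = x (-1)" "deg M (\<sigma> x) = deg M x"
      using sgn_actD(1-3)[OF a x] x by auto
    show "\<sigma> x k = x k" if k: "k \<in> {1..int M}" for k
      using sgn_actD(4)[OF a x k] xk[OF k] xk[OF perm_in(3)[OF s k]] xm by simp
  qed
  thus "x \<in> {x \<in> lat M. \<forall>\<sigma>\<in>H. \<sigma> x = x}" using x by auto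
qed

lemma two_flip_blocks:
  assumes M: "M = N1 + N2 + 1" and odd: "odd N1" "odd N2"
    and Q1: "flip_block (block1 N1) Q1 s1 t1" and Q2: "flip_block (block2 N1 N2) Q2 s2 t2"
    and gens: "gens = {(block1 N1 \<union> {int M}, s1), ({}, t1)} \<union> {(block2 N1 N2 \<union> {int M}, s2), ({}, t2)}"
  shows "cond_H1 M (gen_grp M gens) \<and> rel_min M (gen_grp M gens)"
proof -
  interpret Q1: flip_block "block1 N1" Q1 s1 t1 by fact
  interpret Q2: flip_block "block2 N1 N2" Q2 s2 t2 by fact
  have d: "block1 N1 \<inter> block2 N1 N2 = {}" "int M \<notin> block1 N1" "int M \<notin> block2 N1 N2"
    using M by (auto simp: block1_def block2_def)
  have I: "{1..int M} = block1 N1 \<union> block2 N1 N2 \<union> {int M}"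
    using M by (auto simp: block1_def block2_def)
  \<comment> \<open>On the other block a generator agrees with the unflipped identity, which is
    admissible there.\<close>
  have "\<And>k. k \<in> block2 N1 N2 \<Longrightarrow> id k = s1 k" "\<And>k. k \<in> block2 N1 N2 \<Longrightarrow> id k = t1 k"
    using d(1) Q1.s_outside Q1.t_outside by (metis disjoint_iff id_apply)+
  note Q2_id = this[THEN Q2.Q_cong[OF Q2.Q_id]]
  have "\<And>k. k \<in> block1 N1 \<Longrightarrow> id k = s2 k" "\<And>k. k \<in> block1 N1 \<Longrightarrow> id k = t2 k"
    using d(1) Q2.s_outside Q2.t_outside by (metis disjoint_iff id_apply)+
  note Q1_id = this[THEN Q1.Q_cong[OF Q1.Q_id]]
  have g: "\<exists>e1 e2. fst g = {k \<in> {1..int M}. block_flip N1 N2 e1 e2 k} \<and>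
           Q1 (snd g) e1 \<and> Q2 (snd g) e2 \<and> snd g (int M) = int M" if g: "g \<in> gens" for g
  proof -
    have out: "s1 (int M) = int M" "t1 (int M) = int M" "s2 (int M) = int M" "t2 (int M) = int M"
      using d Q1.s_outside Q1.t_outside Q2.s_outside Q2.t_outside by auto
    have flips: "block1 N1 \<union> {int M} = {k \<in> {1..int M}. block_flip N1 N2 True False k}"
      "block2 N1 N2 \<union> {int M} = {k \<in> {1..int M}. block_flip N1 N2 False True k}"
      "{} = {k \<in> {1..int M}. block_flip N1 N2 False False k}"
      using d unfolding I by (auto simp: block_flip_def)
    consider "g = (block1 N1 \<union> {int M}, s1)" | "g = ({}, t1)" | "g = (block2 N1 N2 \<union> {int M}, s2)" | "g = ({}, t2)"
      using g unfolding gens by blast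
    thus ?thesis
    proof cases
      case 1
      show ?thesis unfolding 1 fst_conv snd_conv using Q1.Q_s Q2_id out flips(1) by blast
    next
      case 2
      show ?thesis unfolding 2 fst_conv snd_conv using Q1.Q_t Q2_id out flips(3) by blast
    next
      case 3
      show ?thesis unfolding 3 fst_conv snd_conv using Q2.Q_s Q1_id out flips(2) by blast
    next
      case 4
      show ?thesis unfolding 4 fst_conv snd_conv using Q2.Q_t Q1_id out flips(3) by blast
    qed
  qed
  have tb: "two_block_action N1 N2 M (gen_grp M gens)"
    "\<And>g. g \<in> gens \<Longrightarrow> restrict (Phi M g) (lat M) \<in> gen_grp M gens"
    "\<And>g. g \<in> gens \<Longrightarrow> sgn_act M (restrict (Phi M g) (lat M)) (\<lambda>k. k \<in> fst g) (snd g)"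
    by (rule two_block_action_generated[OF M odd Q1 Q2 g]; assumption)+
  interpret H: two_block_action N1 N2 M "gen_grp M gens" by (rule tb(1))
  have "H1_vanish (lat M) H'" if "subgroup H' (BijGroup (lat M))" "H' \<subseteq> gen_grp M gens" for H'
    by (rule two_block_action.H1_vanish_two_block[OF H.two_block_subgroup[OF that]])
  hence "cond_H1 M (gen_grp M gens)" unfolding cond_H1_def by blast
  moreover have "rel_min M (gen_grp M gens)"
  proof (rule H.rel_minI)
    fix x k assume x: "x \<in> lat M" and inv: "\<And>\<sigma>. \<sigma> \<in> gen_grp M gens \<Longrightarrow> \<sigma> x = x" and k: "k \<in> {1..int M}"
    have eq: "x j = (if j \<in> J then - x (-1) - x (\<tau> j) else x (\<tau> j))"
      if "(J, \<tau>) \<in> gens" "j \<in> {1..int M}" for J \<tau> j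
      using sgn_actD(4)[OF tb(3)[OF that(1)] x that(2)] inv[OF tb(2)[OF that(1)]] by simp
    have "2 * x j = - x (-1)" if j: "j \<in> block1 N1" for j
    proof (rule Q1.invariant[OF _ _ j])
      show "x i = - x (-1) - x (s1 i)" if "i \<in> block1 N1" for i
        using eq[of "block1 N1 \<union> {int M}" s1 i] that I gens by auto
      show "x i = x (t1 i)" if "i \<in> block1 N1" for i using eq[of "{}" t1 i] that I gens by auto
    qed
    moreover have "2 * x j = - x (-1)" if j: "j \<in> block2 N1 N2" for j
    proof (rule Q2.invariant[OF _ _ j])
      show "x i = - x (-1) - x (s2 i)" if "i \<in> block2 N1 N2" for i
        using eq[of "block2 N1 N2 \<union> {int M}" s2 i] that I gens by auto
      show "x i = x (t2 i)" if "i \<in> block2 N1 N2" for i using eq[of "{}" t2 i] that I gens by auto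
    qed
    \<comment> \<open>The extra index is fixed by s1 but flipped, so invariance reads x_M = -x_{-1}
      - x_M.\<close>
    moreover have "2 * x (int M) = - x (-1)"
      using eq[of "block1 N1 \<union> {int M}" s1 "int M"] I gens Q1.s_outside[OF d(2)] by auto
    ultimately show "2 * x k = - x (-1)" using k unfolding I by auto
  qed
  ultimately show ?thesis ..
qed

section \<open>The dihedral block\<close>

text \<open>The position of an index along the cycle \<open>g\<^sub>2\<close>, as a representative modulo \<open>2m + 1\<close>.\<close>

definition dih_pos :: "int \<Rightarrow> int \<Rightarrow> int" where
  "dih_pos off x = (if even (x - off) then (x - off) div 2 else - ((x - off) div 2))"

text \<open>In terms of positions these are the maps x -> x + c and x -> -x + c of Z/(2m+1), the
  reflections being the flipping ones.\<close>

definition dih_perm :: "nat \<Rightarrow> int \<Rightarrow> (int \<Rightarrow> int) \<Rightarrow> bool \<Rightarrow> bool" where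
  "dih_perm m off \<tau> e \<longleftrightarrow> (\<exists>c. \<forall>x\<in>{off + 1..off + 2 * int m + 1}. \<tau> x \<in> {off + 1..off + 2 * int m + 1} \<and>
     (2 * int m + 1) dvd (dih_pos off (\<tau> x) - ((if e then - dih_pos off x else dih_pos off x) + c)))"

text \<open>Positions lie between -m and m, so congruent ones are equal.\<close>

lemma dih_pos_inj:
  assumes "x \<in> {off + 1..off + 2 * int m + 1}" "y \<in> {off + 1..off + 2 * int m + 1}"
    and "(2 * int m + 1) dvd (dih_pos off x - dih_pos off y)"
  shows "x = y"
proof -
  have b: "- int m \<le> dih_pos off x" "dih_pos off x \<le> int m" "- int m \<le> dih_pos off y" "dih_pos off y \<le> int m"
    using assms(1,2) by (auto simp: dih_pos_def)
  have "dih_pos off x - dih_pos off y = 0"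
  proof (rule ccontr)
    assume "dih_pos off x - dih_pos off y \<noteq> 0"
    from dvd_imp_le_int[OF this assms(3)] show False using b by linarith
  qed
  thus ?thesis using assms(1,2) by (auto simp: dih_pos_def split: if_splits) presburger+
qed

lemma cyc_nth:
  assumes "distinct xs" "i < length xs"
  shows "cyc xs (xs ! i) = xs ! (Suc i mod length xs)"
proof -
  let ?ys = "tl xs @ [hd xs]"
  have ne: "xs \<noteq> []" using assms(2) by auto
  have len: "length ?ys = length xs" using ne by simp
  have "map_of (zip xs ?ys) (xs ! i) = Some (?ys ! i)"
    using assms len by (intro map_of_zip_nth) auto
  moreover have "?ys ! i = xs ! (Suc i mod length xs)"
  proof (cases "Suc i < length xs")
    case True
    hence "i < length xs - Suc 0" by linarith
    thus ?thesis using True by (simp add: nth_append nth_tl)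
  next
    case False
    hence "Suc i = length xs" "\<not> i < length xs - Suc 0" using assms(2) by simp_all
    thus ?thesis using ne by (simp add: nth_append hd_conv_nth)
  qed
  ultimately show ?thesis by (simp add: cyc_def)
qed

lemma cyc_outside: "x \<notin> set xs \<Longrightarrow> cyc xs x = x"
proof -
  assume "x \<notin> set xs"
  hence "map_of (zip xs (tl xs @ [hd xs])) x = None"
    by (auto simp: map_of_eq_None_iff dest: set_zip_leftD)
  thus ?thesis by (simp add: cyc_def)
qed

lemma length_dih_list: "length (dih_list m off) = 2 * m + 1"
  by (simp add: dih_list_def)

lemma dih_list_nth:
  assumes "i < 2 * m + 1"
  shows "dih_list m off ! i = off + (if i = 0 then 1 else if i \<le> m then 2 * int i else 2 * (2 * int m + 1 - int i) + 1)"
proof -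
  consider "i = 0" | "0 < i" "i \<le> m" | "m < i" by linarith
  thus ?thesis
  proof cases
    case 1
    thus ?thesis by (simp add: dih_list_def)
  next
    case 2
    hence "i - Suc 0 < m" by linarith
    thus ?thesis using 2 by (simp add: dih_list_def nth_append nth_Cons' of_nat_diff)
  next
    case 3
    hence "\<not> i - Suc 0 < m" by linarith
    thus ?thesis using 3 assms by (simp add: dih_list_def nth_append nth_Cons' rev_nth of_nat_diff)
  qed
qed

lemma dih_pos_nth:
  assumes "i < 2 * m + 1"
  shows "(2 * int m + 1) dvd (dih_pos off (dih_list m off ! i) - int i)"
    and "dih_list m off ! i \<in> {off + 1..off + 2 * int m + 1}"
proof -
  \<comment> \<open>The second half of the cycle runs through the odd labels downwards, that is,
    through the negative positions -m, ..., -1.\<close>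
  have "dih_pos off (dih_list m off ! i) = (if i \<le> m then int i else int i - (2 * int m + 1))"
    unfolding dih_list_nth[OF assms] using assms by (auto simp: dih_pos_def)
  hence "dih_pos off (dih_list m off ! i) - int i = (if i \<le> m then 0 else -1) * (2 * int m + 1)" by simp
  thus "(2 * int m + 1) dvd (dih_pos off (dih_list m off ! i) - int i)" by (simp only: dvd_triv_right)
  show "dih_list m off ! i \<in> {off + 1..off + 2 * int m + 1}"
    unfolding dih_list_nth[OF assms] using assms by auto
qed

lemma dih_list_distinct_set:
  shows "distinct (dih_list m off)" and "set (dih_list m off) = {off + 1..off + 2 * int m + 1}"
proof -
  show d: "distinct (dih_list m off)"
  proof (unfold distinct_conv_nth length_dih_list, intro allI impI notI)
    fix i j assume ij: "i < 2 * m + 1" "j < 2 * m + 1" "i \<noteq> j" "dih_list m off ! i = dih_list m off ! j"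
    have "(2 * int m + 1) dvd (int i - int j)"
      using dvd_diff[OF dih_pos_nth(1)[OF ij(2), of off] dih_pos_nth(1)[OF ij(1), of off]] ij(4) by simp
    thus False using ij(1-3) dvd_imp_le_int[of "int i - int j" "2 * int m + 1"] by auto
  qed
  have "set (dih_list m off) \<subseteq> {off + 1..off + 2 * int m + 1}"
    using dih_pos_nth(2) by (auto simp: in_set_conv_nth length_dih_list)
  moreover have "card (set (dih_list m off)) = card {off + 1..off + 2 * int m + 1}"
    using distinct_card[OF d] by (simp add: length_dih_list)
  ultimately show "set (dih_list m off) = {off + 1..off + 2 * int m + 1}"
    by (intro card_subset_eq) auto
qed

lemma cyc_dih_list:
  assumes "x \<in> {off + 1..off + 2 * int m + 1}"
  shows "cyc (dih_list m off) x \<in> {off + 1..off + 2 * int m + 1}"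
    and "(2 * int m + 1) dvd (dih_pos off (cyc (dih_list m off) x) - (dih_pos off x + 1))"
proof -
  let ?l = "dih_list m off"
  obtain i where i: "i < 2 * m + 1" "x = ?l ! i"
    using assms unfolding dih_list_distinct_set(2)[symmetric] by (auto simp: in_set_conv_nth length_dih_list)
  let ?j = "Suc i mod (2 * m + 1)"
  have c: "cyc ?l x = ?l ! ?j"
    using cyc_nth[OF dih_list_distinct_set(1), of i m off] i by (simp add: length_dih_list)
  have j: "?j < 2 * m + 1" by simp
  show "cyc ?l x \<in> {off + 1..off + 2 * int m + 1}" unfolding c by (rule dih_pos_nth(2)[OF j])
  have "int ?j - (int i + 1) = (if Suc i = 2 * m + 1 then -1 else 0) * (2 * int m + 1)"
    using i(1) by auto
  hence "(2 * int m + 1) dvd (int ?j - (int i + 1))" by (simp only: dvd_triv_right)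
  hence "(2 * int m + 1) dvd ((dih_pos off (?l ! ?j) - int ?j) - (dih_pos off x - int i) + (int ?j - (int i + 1)))"
    unfolding i(2) by (rule dvd_add[OF dvd_diff[OF dih_pos_nth(1)[OF j] dih_pos_nth(1)[OF i(1)]]])
  thus "(2 * int m + 1) dvd (dih_pos off (cyc ?l x) - (dih_pos off x + 1))" unfolding c by (simp add: algebra_simps)
qed

text \<open>The labels off + 2k and off + 2k + 1 have positions k and -k, and the fixed label off +
  1 has position 0.\<close>

lemma dih_swap_pos:
  assumes "x \<in> {off + 1..off + 2 * int m + 1}"
  shows "dih_swap m off x \<in> {off + 1..off + 2 * int m + 1}"
    and "dih_pos off (dih_swap m off x) = - dih_pos off x"
proof -
  obtain j where j: "x = off + j" "1 \<le> j" "j \<le> 2 * int m + 1"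
    using assms by (intro that[of "x - off"]) auto
  show "dih_swap m off x \<in> {off + 1..off + 2 * int m + 1}"
    using j by (auto simp: dih_swap_def elim!: evenE oddE)
  show "dih_pos off (dih_swap m off x) = - dih_pos off x"
    using j by (auto simp: dih_swap_def dih_pos_def elim!: evenE oddE)
qed

lemma flip_block_dihedral:
  "flip_block {off + 1..off + 2 * int m + 1} (dih_perm m off) (dih_swap m off) (cyc (dih_list m off))"
proof -
  let ?A = "{off + 1..off + 2 * int m + 1}" and ?n = "2 * int m + 1"
  let ?d = "dih_pos off"
  show ?thesis
  proof (rule flip_block.intro)
    show "dih_perm m off id False" unfolding dih_perm_def by (intro exI[where x = 0]) auto
    show "dih_perm m off (\<lambda>k. \<tau>' (\<tau> k)) (e \<noteq> e')"
      if "dih_perm m off \<tau> e" "dih_perm m off \<tau>' e'" for \<tau> e \<tau>' e'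
    proof -
      obtain c c' where c: "\<And>x. x \<in> ?A \<Longrightarrow> \<tau> x \<in> ?A \<and> ?n dvd (?d (\<tau> x) - ((if e then - ?d x else ?d x) + c))"
        and c': "\<And>x. x \<in> ?A \<Longrightarrow> \<tau>' x \<in> ?A \<and> ?n dvd (?d (\<tau>' x) - ((if e' then - ?d x else ?d x) + c'))"
        using \<open>dih_perm m off \<tau> e\<close> \<open>dih_perm m off \<tau>' e'\<close> unfolding dih_perm_def by metis
      have "\<tau>' (\<tau> x) \<in> ?A \<and> ?n dvd (?d (\<tau>' (\<tau> x)) - ((if e \<noteq> e' then - ?d x else ?d x) + ((if e' then - c else c) + c')))"
        if x: "x \<in> ?A" for x
      proof -
        let ?u = "?d (\<tau> x) - ((if e then - ?d x else ?d x) + c)"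
        have "?n dvd (?d (\<tau>' (\<tau> x)) - ((if e' then - ?d (\<tau> x) else ?d (\<tau> x)) + c')) + (if e' then - ?u else ?u)"
        proof (rule dvd_add)
          show "?n dvd ?d (\<tau>' (\<tau> x)) - ((if e' then - ?d (\<tau> x) else ?d (\<tau> x)) + c')"
            using c[OF x] c'[of "\<tau> x"] by blast
          show "?n dvd (if e' then - ?u else ?u)"
            using c[OF x] by (cases e') (simp_all only: if_True if_False dvd_minus_iff)
        qed
        also have "\<dots> = ?d (\<tau>' (\<tau> x)) - ((if e \<noteq> e' then - ?d x else ?d x) + ((if e' then - c else c) + c'))"
          by auto
        finally show ?thesis using c[OF x] c'[of "\<tau> x"] by blast
      qed
      thus ?thesis unfolding dih_perm_def by blast
    qed
    show "dih_perm m off \<tau>' e" if "dih_perm m off \<tau> e" "\<And>k. k \<in> ?A \<Longrightarrow> \<tau> k = \<tau>' k" for \<tau> \<tau>' e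
      using that unfolding dih_perm_def by simp
    show "frobenius_on ?A \<tau> e" if "dih_perm m off \<tau> e" for \<tau> e
    proof -
      obtain c where c: "\<And>x. x \<in> ?A \<Longrightarrow> \<tau> x \<in> ?A \<and> ?n dvd (?d (\<tau> x) - ((if e then - ?d x else ?d x) + c))"
        using \<open>dih_perm m off \<tau> e\<close> unfolding dih_perm_def by blast
      have diff: "?n dvd (?d (\<tau> x) - ?d (\<tau> y)) - (if e then - (?d x - ?d y) else ?d x - ?d y)"
        if "x \<in> ?A" "y \<in> ?A" for x y
        using dvd_diff[OF conjunct2[OF c[OF that(1)]] conjunct2[OF c[OF that(2)]]]
        by (auto simp: algebra_simps)
      have "inj_on \<tau> ?A"
      proof (rule inj_onI)
        fix x y assume xy: "x \<in> ?A" "y \<in> ?A" "\<tau> x = \<tau> y"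
        have "?n dvd ?d x - ?d y" using diff[OF xy(1,2)] xy(3) by (auto simp: dvd_diff_commute split: if_splits)
        thus "x = y" by (rule dih_pos_inj[OF xy(1,2)])
      qed
      moreover have "\<tau> ` ?A \<subseteq> ?A" using c by blast
      ultimately have "bij_betw \<tau> ?A ?A" by (simp add: bij_betw_def endo_inj_surj)
      moreover have "\<not> e" if "a \<in> ?A" "v \<in> ?A" "a \<noteq> v" "\<tau> a = a" "\<tau> v = v" for a v
      proof
        assume e
        \<comment> \<open>Two fixed points of the same reflection differ by an element killed by 2,
          and 2 is invertible modulo 2m + 1.\<close>
        hence "?n dvd 2 * (?d a - ?d v)" using diff[OF that(1,2)] that(4,5) by (simp add: algebra_simps)
        moreover have "coprime ?n 2" by simp
        ultimately have "?n dvd ?d a - ?d v" using coprime_dvd_mult_right_iff by blast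
        thus False using dih_pos_inj[OF that(1,2)] that(3) by blast
      qed
      ultimately show ?thesis unfolding frobenius_on_def by blast
    qed
    show "dih_perm m off (dih_swap m off) True"
      unfolding dih_perm_def using dih_swap_pos by (intro exI[where x = 0]) auto
    show "dih_perm m off (cyc (dih_list m off)) False"
      unfolding dih_perm_def using cyc_dih_list by (intro exI[where x = 1]) auto
    show "dih_swap m off k = k" if "k \<notin> ?A" for k using that by (auto simp: dih_swap_def)
    show "cyc (dih_list m off) k = k" if "k \<notin> ?A" for k
      using that by (intro cyc_outside) (simp add: dih_list_distinct_set(2))
    show "2 * x k = b" if s: "\<And>k. k \<in> ?A \<Longrightarrow> x k = b - x (dih_swap m off k)"
      and t: "\<And>k. k \<in> ?A \<Longrightarrow> x k = x (cyc (dih_list m off) k)" and k: "k \<in> ?A" for x :: "int \<Rightarrow> int" and b k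
    proof -
      let ?l = "dih_list m off"
      \<comment> \<open>The cycle is transitive on the block, so x is constant there; the swap then
        gives 2 x_k = b.\<close>
      have "x (?l ! i) = x (?l ! 0)" if "i < 2 * m + 1" for i
        using that
      proof (induction i)
        case (Suc i)
        have "x (?l ! i) = x (cyc ?l (?l ! i))" using Suc.prems by (intro t dih_pos_nth(2)) simp
        thus ?case using Suc cyc_nth[OF dih_list_distinct_set(1), of i m off] by (simp add: length_dih_list)
      qed simp
      note step = this
      have const: "x j = x (?l ! 0)" if "j \<in> ?A" for j
      proof -
        have "j \<in> set ?l" unfolding dih_list_distinct_set(2) by (rule that)
        then obtain i where i: "i < length ?l" "?l ! i = j" unfolding in_set_conv_nth by (elim exE conjE)
        have "x (?l ! i) = x (?l ! 0)" using i(1) unfolding length_dih_list by (rule step)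
        thus ?thesis unfolding i(2) .
      qed
      show ?thesis using s[OF k] const[OF k] const[OF dih_swap_pos(1)[OF k]] by simp
    qed
  qed
qed

section \<open>The finite field block\<close>

text \<open>Agrees with \<open>lab\<close> except at 0, which \<open>lab\<close> sends to q; this
  regular version is the one suited to induction on the number of digits.\<close>

definition digit_sum :: "nat \<Rightarrow> 'p::prime_card mod_ring poly \<Rightarrow> int" where
  "digit_sum r a = (\<Sum>i<r. to_int_mod_ring (coeff a i) * int CARD('p) ^ i)"

lemma to_int_mod_ring_range:
  fixes c :: "'p::prime_card mod_ring"
  shows "0 \<le> to_int_mod_ring c" "to_int_mod_ring c < int CARD('p)"
  using range_to_int_mod_ring[where 'a = 'p] by (auto simp: set_eq_iff)

lemma digit_sum_range:
  fixes a :: "'p::prime_card mod_ring poly"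
  shows "0 \<le> digit_sum r a" "digit_sum r a < int CARD('p) ^ r"
proof -
  show "0 \<le> digit_sum r a" unfolding digit_sum_def
    by (intro sum_nonneg mult_nonneg_nonneg to_int_mod_ring_range) auto
  show "digit_sum r a < int CARD('p) ^ r"
  proof (induction r)
    case (Suc r)
    have "to_int_mod_ring (coeff a r) * int CARD('p) ^ r \<le> (int CARD('p) - 1) * int CARD('p) ^ r"
      using to_int_mod_ring_range(2)[of "coeff a r"] by (intro mult_right_mono) auto
    thus ?case using Suc by (simp add: digit_sum_def algebra_simps)
  qed (simp add: digit_sum_def)
qed

text \<open>The lower r digits sum to less than p^r, so division by p^r recovers the top
  digit.\<close>

lemma digit_sum_inj:
  fixes a b :: "'p::prime_card mod_ring poly"
  assumes "digit_sum r a = digit_sum r b" "i < r"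
  shows "coeff a i = coeff b i"
  using assms
proof (induction r)
  case (Suc r)
  let ?q = "int CARD('p) ^ r"
  have q: "?q > 0" by simp
  have split: "digit_sum (Suc r) c = digit_sum r c + to_int_mod_ring (coeff c r) * ?q" for c :: "'p mod_ring poly"
    by (simp add: digit_sum_def)
  have div: "digit_sum (Suc r) c div ?q = to_int_mod_ring (coeff c r)" for c :: "'p mod_ring poly"
    unfolding split using digit_sum_range[of r c] q by (simp add: div_pos_pos_trivial)
  have "to_int_mod_ring (coeff a r) = to_int_mod_ring (coeff b r)" using div[of a] div[of b] Suc.prems(1) by simp
  hence top: "coeff a r = coeff b r" by (metis of_int_mod_ring_to_int_mod_ring)
  hence "digit_sum r a = digit_sum r b" using Suc.prems(1) unfolding split by simp
  thus ?case using Suc top by (cases "i = r") auto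
qed simp

lemma digit_sum_surj:
  assumes "0 \<le> n" "n < int CARD('p) ^ r"
  shows "\<exists>a :: 'p::prime_card mod_ring poly. (\<forall>i\<ge>r. coeff a i = 0) \<and> digit_sum r a = n"
  using assms
proof (induction r arbitrary: n)
  case 0
  thus ?case by (intro exI[of _ 0]) (simp add: digit_sum_def)
next
  case (Suc r)
  let ?q = "int CARD('p) ^ r"
  have q: "?q > 0" by simp
  obtain a :: "'p mod_ring poly" where a: "\<forall>i\<ge>r. coeff a i = 0" "digit_sum r a = n mod ?q"
    using Suc.IH[of "n mod ?q"] q by auto
  have "\<not> int CARD('p) \<le> n div ?q"
  proof
    assume "int CARD('p) \<le> n div ?q"
    hence "int CARD('p) * ?q \<le> (n div ?q) * ?q" by (rule mult_right_mono) simp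
    also have "\<dots> \<le> n" using div_mult_mod_eq[of n ?q] pos_mod_sign[OF q, of n] by linarith
    finally show False using Suc.prems(2) by simp
  qed
  hence d: "0 \<le> n div ?q" "n div ?q < int CARD('p)"
    using Suc.prems(1) pos_imp_zdiv_nonneg_iff[OF q, of n] by simp_all
  let ?b = "a + monom (of_int_mod_ring (n div ?q)) r"
  have "(\<Sum>i<r. to_int_mod_ring (coeff ?b i) * int CARD('p) ^ i) = (\<Sum>i<r. to_int_mod_ring (coeff a i) * int CARD('p) ^ i)"
    by (rule sum.cong) auto
  hence "digit_sum (Suc r) ?b = n mod ?q + (n div ?q) * ?q"
    using a d by (simp add: digit_sum_def)
  hence "digit_sum (Suc r) ?b = n" by (simp only: mod_div_mult_eq)
  moreover have "\<forall>i\<ge>Suc r. coeff ?b i = 0" using a(1) by simp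
  ultimately show ?case by blast
qed

definition residues_below :: "'p::prime_card mod_ring poly \<Rightarrow> 'p mod_ring poly set" where
  "residues_below h = {a. degree a < degree h}"

lemma lab_bij_betw:
  fixes h :: "'p::prime_card mod_ring poly"
  assumes "1 \<le> degree h"
  shows "bij_betw (lab h) (residues_below h) {1..int (CARD('p) ^ degree h)}"
proof -
  let ?r = "degree h"
  have lab: "lab h a = (if a = 0 then int (CARD('p) ^ ?r) else digit_sum ?r a)" for a
    by (simp add: lab_def digit_sum_def)
  have eqI: "a = b" if "a \<in> residues_below h" "b \<in> residues_below h" "digit_sum ?r a = digit_sum ?r b" for a b
  proof (rule poly_eqI)
    fix i
    show "coeff a i = coeff b i"
      using digit_sum_inj[OF that(3), of i] that(1,2)
      by (cases "i < ?r") (auto simp: residues_below_def coeff_eq_0)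
  qed
  have zero: "0 \<in> residues_below h" "digit_sum ?r (0 :: 'p mod_ring poly) = 0"
    using assms by (auto simp: residues_below_def digit_sum_def)
  have pos: "0 < digit_sum ?r a" if "a \<in> residues_below h" "a \<noteq> 0" for a
  proof -
    have "digit_sum ?r a \<noteq> 0" using eqI[OF that(1) zero(1)] zero(2) that(2) by metis
    thus ?thesis using digit_sum_range(1)[of ?r a] by linarith
  qed
  show ?thesis
  proof (rule bij_betw_imageI)
    show "inj_on (lab h) (residues_below h)"
    proof (rule inj_onI)
      fix a b assume ab: "a \<in> residues_below h" "b \<in> residues_below h" "lab h a = lab h b"
      show "a = b"
        using ab(3) eqI[OF ab(1,2)] digit_sum_range(2)[of ?r a] digit_sum_range(2)[of ?r b]
        by (auto simp: lab split: if_splits)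
    qed
    show "lab h ` residues_below h = {1..int (CARD('p) ^ ?r)}"
    proof (intro equalityI subsetI)
      fix n assume "n \<in> lab h ` residues_below h"
      then obtain a where a: "a \<in> residues_below h" "n = lab h a" by blast
      show "n \<in> {1..int (CARD('p) ^ ?r)}"
        using a pos[OF a(1)] digit_sum_range(2)[of ?r a] by (auto simp: lab Suc_le_eq)
    next
      fix n assume n: "n \<in> {1..int (CARD('p) ^ ?r)}"
      show "n \<in> lab h ` residues_below h"
      proof (cases "n = int (CARD('p) ^ ?r)")
        case True
        thus ?thesis using zero(1) by (intro image_eqI[of _ _ 0]) (simp_all add: lab)
      next
        case False
        then obtain a :: "'p mod_ring poly" where a: "\<forall>i\<ge>?r. coeff a i = 0" "digit_sum ?r a = n"
          using digit_sum_surj[of n ?r, where 'p = 'p] n by auto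
        have "degree a < ?r" using a(1) assms by (metis degree_0 leading_coeff_0_iff not_less order_less_le_trans zero_less_one)
        moreover have "a \<noteq> 0" using a(2) zero(2) n by auto
        ultimately show ?thesis using a(2) by (intro image_eqI[of _ _ a]) (simp_all add: lab residues_below_def)
      qed
    qed
  qed
qed

lemma ff_perm_lab:
  fixes h :: "'p::prime_card mod_ring poly"
  assumes "1 \<le> degree h" "a \<in> residues_below h"
  shows "ff_perm h f off (off + lab h a) = off + lab h (f a)"
proof -
  have "(THE b. degree b < degree h \<and> off + lab h a = off + lab h b) = a"
    using assms(2) inj_onD[OF bij_betw_imp_inj_on[OF lab_bij_betw[OF assms(1)]]]
    by (intro the_equality) (auto simp: residues_below_def)
  thus ?thesis using assms(2) by (auto simp: ff_perm_def residues_below_def)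
qed

lemma ff_perm_outside:
  fixes h :: "'p::prime_card mod_ring poly"
  assumes "1 \<le> degree h" "x \<notin> {off + 1..off + int (CARD('p) ^ degree h)}"
  shows "ff_perm h f off x = x"
proof -
  have "\<not> (\<exists>a. degree a < degree h \<and> x = off + lab h a)"
    using bij_betw_imp_surj_on[OF lab_bij_betw[OF assms(1)]] assms(2)
    by (force simp: residues_below_def)
  thus ?thesis by (simp only: ff_perm_def if_False)
qed

section \<open>Affine maps of F_q and the parity of the exponent\<close>

text \<open>The sign is the parity of an exponent k that the map does not determine;
  \<open>even_of_power_eq_one\<close> shows that this parity is even whenever the linear part is
  trivial.\<close>

definition affine_perm :: "'p::prime_card mod_ring poly \<Rightarrow> 'p mod_ring poly \<Rightarrow> int \<Rightarrow> (int \<Rightarrow> int) \<Rightarrow> bool \<Rightarrow> bool" where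
  "affine_perm h \<Gamma> off \<tau> e \<longleftrightarrow> (\<exists>k c. e = odd k \<and>
     (\<forall>a\<in>residues_below h. \<tau> (off + lab h a) = off + lab h ((\<Gamma> ^ k * a + c) mod h)))"

locale finite_field_generator =
  fixes h \<Gamma> :: "'p::prime_card mod_ring poly"
  assumes irreducible: "irreducible h" and degree_pos: "1 \<le> degree h"
    and odd_char: "odd CARD('p)" and generator: "is_mult_generator h \<Gamma>"
begin

lemma h_nonzero: "h \<noteq> 0"
  using degree_pos by auto

lemma prime_h: "prime_elem h"
  by (rule field_poly_irreducible_imp_prime[OF irreducible])

lemma mod_in_residues: "a mod h \<in> residues_below h"
  using degree_mod_less[OF h_nonzero, of a] degree_pos by (auto simp: residues_below_def)

lemma mod_residue: "a \<in> residues_below h \<Longrightarrow> a mod h = a"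
  by (simp add: residues_below_def mod_poly_less)

lemma finite_residues: "finite (residues_below h)"
  using bij_betw_finite[OF lab_bij_betw[OF degree_pos]] by simp

lemma generator_not_dvd: "\<not> h dvd \<Gamma> ^ k"
proof -
  have "\<not> h dvd \<Gamma>"
    using generator mod_poly_less[of \<Gamma> h] by (auto simp: is_mult_generator_def mod_eq_0_iff_dvd[symmetric])
  thus ?thesis using prime_elem_dvd_power[OF prime_h] by blast
qed

lemma minus_one_neq_one: "(-1 :: 'p mod_ring poly) \<noteq> 1"
proof
  assume "(-1 :: 'p mod_ring poly) = 1"
  from arg_cong[OF this, of "\<lambda>p. coeff p 0"] have "(-1 :: 'p mod_ring) = 1" by simp
  hence "(1 :: 'p mod_ring) + 1 = 0" by (metis add.right_inverse)
  moreover obtain n where "CARD('p) = 2 * n + 1" using odd_char by (elim oddE)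
  hence "(of_nat CARD('p) :: 'p mod_ring) = (1 + 1) * of_nat n + 1" by simp
  ultimately show False by simp
qed

text \<open>If an odd power of \<open>\<Gamma>\<close> were \<open>1\<close>, every unit would be a square, so squaring would be
  injective on the units, contradicting \<open>(-1)\<^sup>2 = 1\<^sup>2\<close>.\<close>

lemma even_of_power_eq_one:
  assumes "h dvd \<Gamma> ^ k - 1"
  shows "even k"
proof (rule ccontr)
  assume k: "odd k"
  let ?U = "residues_below h - {0}" and ?sq = "\<lambda>a. (a * a) mod h"
  have not_dvd: "\<not> h dvd a" if "a \<in> ?U" for a
    using that mod_residue[of a] by (auto simp: mod_eq_0_iff_dvd[symmetric])
  have sub: "?sq ` ?U \<subseteq> ?U"
    using not_dvd mod_in_residues prime_elem_dvd_mult_iff[OF prime_h] by (auto simp: mod_eq_0_iff_dvd)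
  have "?U \<subseteq> ?sq ` ?U"
  proof
    fix u assume u: "u \<in> ?U"
    then obtain j where j: "u = \<Gamma> ^ j mod h"
      using generator by (auto simp: is_mult_generator_def residues_below_def)
    \<comment> \<open>Adding the odd number k to an odd exponent makes it even without changing the
      residue, so every unit is a square.\<close>
    have eq: "\<Gamma> ^ (j + k) mod h = \<Gamma> ^ j mod h"
    proof -
      have "h dvd \<Gamma> ^ j * (\<Gamma> ^ k - 1)" using assms by (rule dvd_mult)
      thus ?thesis by (simp add: mod_eq_dvd_iff power_add algebra_simps)
    qed
    obtain i where i: "\<Gamma> ^ (2 * i) mod h = u"
    proof (cases "even j")
      case True
      thus ?thesis using j by (elim evenE) (auto intro: that)
    next
      case False
      hence "even (j + k)" using k by simp
      thus ?thesis using j eq by (elim evenE) (auto intro: that)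
    qed
    have "?sq (\<Gamma> ^ i mod h) = u" using i by (simp add: mod_mult_eq mult_2 power_add)
    moreover have "\<Gamma> ^ i mod h \<in> ?U" using mod_in_residues generator_not_dvd by (auto simp: mod_eq_0_iff_dvd)
    ultimately show "u \<in> ?sq ` ?U" by blast
  qed
  hence "?sq ` ?U = ?U" using sub by blast
  hence "inj_on ?sq ?U" using finite_residues by (intro eq_card_imp_inj_on) auto
  moreover have "1 \<in> ?U" "-1 \<in> ?U" using degree_pos by (auto simp: residues_below_def)
  moreover have "?sq 1 = ?sq (-1)" by simp
  ultimately show False using minus_one_neq_one by (metis (no_types, lifting) inj_onD)
qed

lemma flip_block_finite_field:
  "flip_block {off + 1..off + int (CARD('p) ^ degree h)} (affine_perm h \<Gamma> off)
     (ff_perm h (\<lambda>a. (\<Gamma> * a) mod h) off) (ff_perm h (\<lambda>a. a + 1) off)"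
proof -
  let ?A = "{off + 1..off + int (CARD('p) ^ degree h)}"
  let ?l = "\<lambda>a. off + lab h a" and ?F = "residues_below h"
  have shift: "bij_betw (\<lambda>x. off + x) {1..int (CARD('p) ^ degree h)} ?A"
    by (rule bij_betwI[where g = "\<lambda>x. x - off"]) auto
  have bij: "bij_betw ?l ?F ?A"
    using bij_betw_trans[OF lab_bij_betw[OF degree_pos] shift] unfolding comp_def .
  have l_in: "?l a \<in> ?A" if "a \<in> ?F" for a using bij_betw_imp_surj_on[OF bij] that by blast
  have l_inj: "a = b" if "?l a = ?l b" "a \<in> ?F" "b \<in> ?F" for a b
    using inj_onD[OF bij_betw_imp_inj_on[OF bij]] that by blast
  have l_cases: "\<exists>a\<in>?F. x = ?l a" if "x \<in> ?A" for x
    using bij_betw_imp_surj_on[OF bij] that by blast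
  show ?thesis
  proof (rule flip_block.intro)
    show "affine_perm h \<Gamma> off id False"
      unfolding affine_perm_def by (rule exI[of _ 0], rule exI[of _ 0]) (simp add: mod_residue)
    show "affine_perm h \<Gamma> off (\<lambda>k. \<tau>' (\<tau> k)) (e \<noteq> e')"
      if t: "affine_perm h \<Gamma> off \<tau> e" "affine_perm h \<Gamma> off \<tau>' e'" for \<tau> e \<tau>' e'
    proof -
      obtain k c where k: "e = odd k" "\<And>a. a \<in> ?F \<Longrightarrow> \<tau> (?l a) = ?l ((\<Gamma> ^ k * a + c) mod h)"
        using t(1) unfolding affine_perm_def by blast
      obtain k' c' where k': "e' = odd k'" "\<And>a. a \<in> ?F \<Longrightarrow> \<tau>' (?l a) = ?l ((\<Gamma> ^ k' * a + c') mod h)"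
        using t(2) unfolding affine_perm_def by blast
      have "\<tau>' (\<tau> (?l a)) = ?l ((\<Gamma> ^ (k + k') * a + (\<Gamma> ^ k' * c + c')) mod h)" if a: "a \<in> ?F" for a
      proof -
        have "(\<Gamma> ^ k' * ((\<Gamma> ^ k * a + c) mod h) + c') mod h = (\<Gamma> ^ k' * (\<Gamma> ^ k * a + c) + c') mod h"
          by (metis mod_add_left_eq mod_mult_right_eq)
        also have "\<Gamma> ^ k' * (\<Gamma> ^ k * a + c) + c' = \<Gamma> ^ (k + k') * a + (\<Gamma> ^ k' * c + c')"
          by (simp add: power_add algebra_simps)
        finally show ?thesis unfolding k(2)[OF a] k'(2)[OF mod_in_residues] by simp
      qed
      moreover have "(e \<noteq> e') = odd (k + k')" using k(1) k'(1) by auto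
      ultimately show ?thesis unfolding affine_perm_def by blast
    qed
    show "affine_perm h \<Gamma> off \<tau>' e" if "affine_perm h \<Gamma> off \<tau> e" "\<And>k. k \<in> ?A \<Longrightarrow> \<tau> k = \<tau>' k" for \<tau> \<tau>' e
      using that(1) that(2)[OF l_in] unfolding affine_perm_def by simp
    show "frobenius_on ?A \<tau> e" if t: "affine_perm h \<Gamma> off \<tau> e" for \<tau> e
    proof -
      obtain k c where k: "e = odd k" "\<And>a. a \<in> ?F \<Longrightarrow> \<tau> (?l a) = ?l ((\<Gamma> ^ k * a + c) mod h)"
        using t unfolding affine_perm_def by blast
      have eqI: "a = b" if "a \<in> ?F" "b \<in> ?F" "h dvd a - b" for a b
        using that mod_residue[of a] mod_residue[of b] by (metis mod_eq_dvd_iff)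
      have "inj_on \<tau> ?A"
      proof (rule inj_onI)
        fix x y assume xy: "x \<in> ?A" "y \<in> ?A" "\<tau> x = \<tau> y"
        obtain a b where ab: "a \<in> ?F" "x = ?l a" "b \<in> ?F" "y = ?l b" using l_cases xy(1,2) by meson
        have "(\<Gamma> ^ k * a + c) mod h = (\<Gamma> ^ k * b + c) mod h"
          using xy(3) k(2) ab by (intro l_inj mod_in_residues) simp
        hence "h dvd \<Gamma> ^ k * (a - b)" by (simp add: mod_eq_dvd_iff algebra_simps)
        hence "h dvd a - b" using prime_elem_dvd_mult_iff[OF prime_h] generator_not_dvd by blast
        hence "a = b" by (rule eqI[OF ab(1,3)])
        thus "x = y" using ab(2,4) by simp
      qed
      moreover have "\<tau> ` ?A \<subseteq> ?A"
      proof (rule image_subsetI)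
        fix x assume "x \<in> ?A"
        then obtain a where "a \<in> ?F" "x = ?l a" using l_cases by blast
        thus "\<tau> x \<in> ?A" using k(2) l_in[OF mod_in_residues] by simp
      qed
      ultimately have "bij_betw \<tau> ?A ?A" by (simp add: bij_betw_def endo_inj_surj)
      moreover have "\<not> e" if xy: "x \<in> ?A" "y \<in> ?A" "x \<noteq> y" "\<tau> x = x" "\<tau> y = y" for x y
      proof -
        obtain a b where ab: "a \<in> ?F" "x = ?l a" "b \<in> ?F" "y = ?l b" using l_cases xy(1,2) by meson
        have "(\<Gamma> ^ k * a + c) mod h = a" "(\<Gamma> ^ k * b + c) mod h = b"
          using xy(4,5) k(2) ab by (auto intro!: l_inj mod_in_residues)
        hence "h dvd (\<Gamma> ^ k * a + c) - a" "h dvd (\<Gamma> ^ k * b + c) - b"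
          using mod_residue[OF ab(1)] mod_residue[OF ab(3)] by (metis mod_eq_dvd_iff)+
        \<comment> \<open>Subtracting the two fixed-point equations removes c; as the points differ,
          \<Gamma>^k is 1 modulo h and k is even.\<close>
        hence "h dvd ((\<Gamma> ^ k * a + c) - a) - ((\<Gamma> ^ k * b + c) - b)" by (rule dvd_diff)
        hence "h dvd (\<Gamma> ^ k - 1) * (a - b)" by (simp add: algebra_simps)
        hence "h dvd \<Gamma> ^ k - 1" using prime_elem_dvd_mult_iff[OF prime_h] eqI[OF ab(1,3)] xy(3) ab by blast
        thus "\<not> e" using even_of_power_eq_one k(1) by simp
      qed
      ultimately show ?thesis unfolding frobenius_on_def by blast
    qed
    show "affine_perm h \<Gamma> off (ff_perm h (\<lambda>a. (\<Gamma> * a) mod h) off) True"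
      unfolding affine_perm_def
      by (rule exI[of _ 1], rule exI[of _ 0]) (simp add: ff_perm_lab[OF degree_pos])
    have plus_one: "a + 1 \<in> ?F" if "a \<in> ?F" for a
      using that degree_pos degree_add_le_max[of a 1] by (auto simp: residues_below_def)
    show "affine_perm h \<Gamma> off (ff_perm h (\<lambda>a. a + 1) off) False"
      unfolding affine_perm_def
      by (rule exI[of _ 0], rule exI[of _ 1]) (simp add: ff_perm_lab[OF degree_pos] mod_residue[OF plus_one])
    show "ff_perm h (\<lambda>a. (\<Gamma> * a) mod h) off k = k" "ff_perm h (\<lambda>a. a + 1) off k = k" if "k \<notin> ?A" for k
      by (rule ff_perm_outside[OF degree_pos that])+
    show "2 * x k = b" if s: "\<And>k. k \<in> ?A \<Longrightarrow> x k = b - x (ff_perm h (\<lambda>a. (\<Gamma> * a) mod h) off k)"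
      and t: "\<And>k. k \<in> ?A \<Longrightarrow> x k = x (ff_perm h (\<lambda>a. a + 1) off k)" and k: "k \<in> ?A" for x :: "int \<Rightarrow> int" and b k
    proof -
      have s': "x (?l a) = b - x (?l ((\<Gamma> * a) mod h))" if "a \<in> ?F" for a
        using s[OF l_in[OF that]] ff_perm_lab[OF degree_pos that] by simp
      have t': "x (?l a) = x (?l (a + 1))" if "a \<in> ?F" for a
        using t[OF l_in[OF that]] ff_perm_lab[OF degree_pos that] by simp
      have zero: "0 \<in> ?F" using degree_pos by (simp add: residues_below_def)
      \<comment> \<open>Translation by 1 need not be transitive on F_q, so both generators are used:
        0 is fixed by the flipping one, translation leads from 0 to 1, and multiplication by
        \<Gamma> leads from 1 to every unit, the equation 2 x = b being preserved by x -> b -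
        x.\<close>
      have 0: "2 * x (?l 0) = b" using s'[OF zero] by simp
      have pow: "2 * x (?l (\<Gamma> ^ j mod h)) = b" for j
      proof (induction j)
        case 0
        have "1 mod h = 1" using degree_pos by (intro mod_residue) (simp add: residues_below_def)
        thus ?case using t'[OF zero] \<open>2 * x (?l 0) = b\<close> by simp
      next
        case (Suc j)
        have "x (?l (\<Gamma> ^ j mod h)) = b - x (?l (\<Gamma> ^ Suc j mod h))"
          using s'[OF mod_in_residues, of "\<Gamma> ^ j"] by (simp add: mod_mult_right_eq)
        thus ?case using Suc by simp
      qed
      obtain a where a: "a \<in> ?F" "k = ?l a" using l_cases[OF k] by blast
      show ?thesis
      proof (cases "a = 0")
        case False
        then obtain j where "a = \<Gamma> ^ j mod h"
          using generator a(1) by (auto simp: is_mult_generator_def residues_below_def)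
        thus ?thesis using pow a(2) by simp
      qed (use 0 a(2) in simp)
    qed
  qed
qed

end

section \<open>The two families of groups\<close>

theorem theorem7p4:
  shows "(\<forall>n1 n2 :: nat. 1 \<le> n1 \<and> 1 \<le> n2 \<longrightarrow>
           (let N1 = 2 * n1 + 1; N2 = 2 * n2 + 1; M = N1 + N2 + 1;
                H = gen_grp M (dih_gens n1 0 (int M) \<union> dih_gens n2 (int N1) (int M))
            in cond_H1 M H \<and> rel_min M H))
       \<and> (\<forall>(n :: nat) (h :: 'p::prime_card mod_ring poly) \<Gamma>.
           odd CARD('p) \<and> 1 \<le> n \<and> lead_coeff h = 1 \<and> irreducible h \<and> 1 \<le> degree h
           \<and> is_mult_generator h \<Gamma> \<longrightarrow>
           (let N1 = 2 * n + 1; N2 = CARD('p) ^ degree h; M = N1 + N2 + 1;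
                H = gen_grp M (dih_gens n 0 (int M) \<union> ff_gens h \<Gamma> (int N1) (int M))
            in cond_H1 M H \<and> rel_min M H))"
proof -
  have dih1: "flip_block (block1 (2 * n + 1)) (dih_perm n 0) (dih_swap n 0) (cyc (dih_list n 0))" for n
    using flip_block_dihedral[of 0 n] by (simp add: block1_def algebra_simps)
  have dih2: "flip_block (block2 N (2 * n + 1)) (dih_perm n (int N)) (dih_swap n (int N)) (cyc (dih_list n (int N)))" for n N
    using flip_block_dihedral[of "int N" n] by (simp add: block2_def algebra_simps)
  have gens1: "dih_gens n 0 s = {(block1 (2 * n + 1) \<union> {s}, dih_swap n 0), ({}, cyc (dih_list n 0))}" for n s
    by (simp add: dih_gens_def block1_def algebra_simps)
  have gens2: "dih_gens n (int N) s = {(block2 N (2 * n + 1) \<union> {s}, dih_swap n (int N)), ({}, cyc (dih_list n (int N)))}" for n N s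
    by (simp add: dih_gens_def block2_def algebra_simps)
  show ?thesis
    unfolding Let_def
  proof (intro conjI allI impI; (elim conjE)?)
    fix n1 n2 :: nat
    let ?M = "2 * n1 + 1 + (2 * n2 + 1) + 1"
    let ?H = "gen_grp ?M (dih_gens n1 0 (int ?M) \<union> dih_gens n2 (int (2 * n1 + 1)) (int ?M))"
    have "cond_H1 ?M ?H \<and> rel_min ?M ?H"
      by (rule two_flip_blocks[OF refl _ _ dih1 dih2]) (simp_all only: gens1 gens2, simp_all)
    thus "cond_H1 ?M ?H" "rel_min ?M ?H" by blast+
  next
    fix n :: nat and h \<Gamma> :: "'p mod_ring poly"
    assume "odd CARD('p)" "irreducible h" "1 \<le> degree h" "is_mult_generator h \<Gamma>"
    then interpret finite_field_generator h \<Gamma> by unfold_locales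
    let ?N = "CARD('p) ^ degree h"
    let ?M = "2 * n + 1 + ?N + 1"
    let ?H = "gen_grp ?M (dih_gens n 0 (int ?M) \<union> ff_gens h \<Gamma> (int (2 * n + 1)) (int ?M))"
    have "cond_H1 ?M ?H \<and> rel_min ?M ?H"
    proof (rule two_flip_blocks[OF refl _ _ dih1])
      show "flip_block (block2 (2 * n + 1) ?N) (affine_perm h \<Gamma> (int (2 * n + 1)))
         (ff_perm h (\<lambda>a. (\<Gamma> * a) mod h) (int (2 * n + 1))) (ff_perm h (\<lambda>a. a + 1) (int (2 * n + 1)))"
        unfolding block2_def by (rule flip_block_finite_field)
      show "odd ?N" using odd_char by simp
      show "dih_gens n 0 (int ?M) \<union> ff_gens h \<Gamma> (int (2 * n + 1)) (int ?M)
        = {(block1 (2 * n + 1) \<union> {int ?M}, dih_swap n 0), ({}, cyc (dih_list n 0))} \<union>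
          {(block2 (2 * n + 1) ?N \<union> {int ?M}, ff_perm h (\<lambda>a. (\<Gamma> * a) mod h) (int (2 * n + 1))),
           ({}, ff_perm h (\<lambda>a. a + 1) (int (2 * n + 1)))}"
        unfolding gens1 ff_gens_def block2_def ..
    qed simp
    thus "cond_H1 ?M ?H" "rel_min ?M ?H" by blast+
  qed
qed

end
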